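(* Let $S=\mathbb{C}[x_0,x_1,x_2]$ with its standard grading. There exists a form $f\in S_{10}$ of Waring rank $22$ and two finite sets of points $Z_1,Z_2\subset\mathbb{P}S_1\cong\mathbb{P}^2$, both computing the rank of $f$, whose Hilbert functions $h_{Z_1}$ and $h_{Z_2}$ are different.
   Context: $S=\bigoplus_{d} S_d=\mathbb{C}[x_0,x_1,x_2]$ is the standard graded polynomial ring over $\mathbb{C}$ (ternary forms). For a homogeneous polynomial $f\in S_d$, the Waring rank $\mathrm{rk}(f)$ is the minimal $r$ such that $f=\sum_{i=1}^r \ell_i^d$ with $\ell_i\in S_1$. Let $\nu_d:\mathbb{P}S_1\to\mathbb{P}S_d$, $[\ell]\mapsto[\ell^d]$, be the Veronese embedding. A finite set of (distinct) points $A\subset\mathbb{P}S_1$ is apolar to $f\in S_d$ if $[f]\in\langle\nu_d(A)\rangle$ (the projective linear span of $\nu_d(A)$), i.e. $f$ is a linear combination of the $d$-th powers of linear forms representing the points of $A$. The set $A$ computes the rank of $f$ if it is apolar to $f$ and its cardinality equals $\mathrm{rk}(f)$. Let $R=\mathbb{C}[y_0,y_1,y_2]$ be the homogeneous coordinate ring of $\mathbb{P}S_1$, where the point $[a_0x_0+a_1x_1+a_2x_2]$ has homogeneous coordinates $(a_0:a_1:a_2)$. For a finite set $A\subset\mathbb{P}S_1$ with homogeneous vanishing ideal $I(A)\subset R$, the Hilbert function of $A$ is $h_A:\mathbb{Z}\to\mathbb{Z}$, $h_A(i)=\dim_{\mathbb{C}}R_i-\dim_{\mathbb{C}}I(A)_i$.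 *)

theory Defs
  imports Complex_Main "HOL-Library.Poly_Mapping" "HOL-Library.Numeral_Type"
begin

text \<open>Complex polynomials in three variables, as finitely supported maps from exponent vectors to
  coefficients, with the convolution product of \<^theory>\<open>HOL-Library.Poly_Mapping\<close>. The type serves
  both for \<open>S = \<complex>[x\<^sub>0,x\<^sub>1,x\<^sub>2]\<close> and for the coordinate ring \<open>R = \<complex>[y\<^sub>0,y\<^sub>1,y\<^sub>2]\<close>.\<close>

type_synonym monom3 = "3 \<Rightarrow>\<^sub>0 nat"
type_synonym poly3 = "monom3 \<Rightarrow>\<^sub>0 complex"

definition scale3 :: "complex \<Rightarrow> poly3 \<Rightarrow> poly3" where
  "scale3 c p = Poly_Mapping.single 0 c * p"

interpretation poly3: vector_space scale3
proof
  fix a b :: complex and p q :: poly3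
  show "scale3 a (p + q) = scale3 a p + scale3 a q"
    by (simp add: scale3_def distrib_left)
  show "scale3 (a + b) p = scale3 a p + scale3 b p"
    by (simp add: scale3_def single_add distrib_right)
  show "scale3 a (scale3 b p) = scale3 (a * b) p"
    by (simp add: scale3_def mult_single mult.assoc [symmetric])
  show "scale3 1 p = p"
    by (simp add: scale3_def)
qed

interpretation poly3_ideal: module "(*) :: poly3 \<Rightarrow> poly3 \<Rightarrow> poly3"
  by unfold_locales (simp_all only: distrib_left distrib_right mult.assoc mult_1)

definition mdeg :: "monom3 \<Rightarrow> nat" where
  "mdeg m = (\<Sum>i\<in>UNIV. Poly_Mapping.lookup m i)"

text \<open>The graded pieces are indexed by all integers; the negative ones are \<open>{0}\<close>.\<close>

definition forms :: "int \<Rightarrow> poly3 set" where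
  "forms d = {p. \<forall>m\<in>Poly_Mapping.keys p. int (mdeg m) = d}"

definition waring_rank :: "nat \<Rightarrow> poly3 \<Rightarrow> nat" where
  "waring_rank d f =
     (LEAST r. \<exists>l :: nat \<Rightarrow> poly3. (\<forall>i<r. l i \<in> forms 1) \<and> f = (\<Sum>i<r. l i ^ d))"

text \<open>The projective space of a linear subspace \<open>V\<close> is the set of its one-dimensional subspaces.\<close>

definition proj_point :: "poly3 \<Rightarrow> poly3 set" where
  "proj_point v = poly3.span {v}"

definition proj :: "poly3 set \<Rightarrow> poly3 set set" where
  "proj V = {proj_point v | v. v \<in> V \<and> v \<noteq> 0}"

definition proj_span :: "poly3 set set \<Rightarrow> poly3 set set" where
  "proj_span X = proj (poly3.span (\<Union>X))"

text \<open>All representatives of a point are used at once, so that no choice is needed; see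
  \<open>veronese_proj_point\<close>.\<close>

definition veronese :: "nat \<Rightarrow> poly3 set \<Rightarrow> poly3 set" where
  "veronese d P = poly3.span ((\<lambda>l. l ^ d) ` P)"

lemma scale3_power: "scale3 c l ^ d = scale3 (c ^ d) (l ^ d)"
proof -
  have "Poly_Mapping.single (0 :: monom3) c ^ d = Poly_Mapping.single 0 (c ^ d)"
    by (induction d) (simp_all add: mult_single)
  then show ?thesis
    by (simp add: scale3_def power_mult_distrib)
qed

lemma veronese_proj_point: "veronese d (proj_point l) = proj_point (l ^ d)"
proof -
  have "l ^ d \<in> (\<lambda>l. l ^ d) ` poly3.span {l}"
    by (rule imageI) (rule poly3.span_base, simp)
  moreover have "(\<lambda>l. l ^ d) ` poly3.span {l} \<subseteq> poly3.span {l ^ d}"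
    by (auto simp: poly3.span_singleton scale3_power)
  ultimately show ?thesis
    unfolding veronese_def proj_point_def
    by (intro subset_antisym poly3.span_minimal poly3.subspace_span poly3.span_mono) auto
qed

text \<open>\<open>[f]\<close> lies in the projective linear span of \<open>\<nu>\<^sub>d(A)\<close>; in particular \<open>f \<noteq> 0\<close>.\<close>

definition apolar :: "nat \<Rightarrow> poly3 set set \<Rightarrow> poly3 \<Rightarrow> bool" where
  "apolar d A f \<longleftrightarrow> proj_point f \<in> proj_span (veronese d ` A)"

definition computes_rank :: "nat \<Rightarrow> poly3 set set \<Rightarrow> poly3 \<Rightarrow> bool" where
  "computes_rank d A f \<longleftrightarrow>
     finite A \<and> A \<subseteq> proj (forms 1) \<and> apolar d A f \<and> card A = waring_rank d f"

definition eval3 :: "poly3 \<Rightarrow> (3 \<Rightarrow> complex) \<Rightarrow> complex" where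
  "eval3 g a =
     (\<Sum>m\<in>Poly_Mapping.keys g. Poly_Mapping.lookup g m * (\<Prod>i\<in>UNIV. a i ^ Poly_Mapping.lookup m i))"

definition coords :: "poly3 \<Rightarrow> 3 \<Rightarrow> complex" where
  "coords l i = Poly_Mapping.lookup l (Poly_Mapping.single i 1)"

definition vanishes_at :: "poly3 \<Rightarrow> poly3 set \<Rightarrow> bool" where
  "vanishes_at g P \<longleftrightarrow> (\<forall>l\<in>P. l \<noteq> 0 \<longrightarrow> eval3 g (coords l) = 0)"

text \<open>The ideal generated by the homogeneous polynomials that vanish on \<open>A\<close>.\<close>

definition vanishing_ideal :: "poly3 set set \<Rightarrow> poly3 set" where
  "vanishing_ideal A = poly3_ideal.span {g. (\<exists>i. g \<in> forms i) \<and> (\<forall>P\<in>A. vanishes_at g P)}"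

definition hilbert_function :: "poly3 set set \<Rightarrow> int \<Rightarrow> int" where
  "hilbert_function A i =
     int (poly3.dim (forms i)) - int (poly3.dim (vanishing_ideal A \<inter> forms i))"

end

theory Submission
  imports Defs "HOL-Computational_Algebra.Computational_Algebra"
begin

text \<open>The form is
\[ f = 210 x^4 ((y+z)^6 + (y-z)^6) + 120 x^3 y^7 + 4 (45 y^2 z^8 + z^{10}). \]
Write a form of degree ten as \<open>\<phi> = \<Sum>\<^sub>k x\<^bsup>10-k\<^esup> \<phi>\<^sub>k\<close> with \<open>\<phi>\<^sub>k\<close> a binary form of degree \<open>k\<close> in
\<open>y, z\<close>. By apolarity \<open>f\<close> is the linear functional
\<open>F(\<phi>) = \<phi>\<^sub>6(1,1) + \<phi>\<^sub>6(1,-1) + \<phi>\<^sub>7(1,0) + B(\<phi>\<^sub>1\<^sub>0)\<close>, where \<open>B\<close> is four times the sum of the coefficients of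
\<open>y\<^sup>2z\<^sup>8\<close> and \<open>z\<^sup>1\<^sup>0\<close>, and a presentation of \<open>f\<close> as a combination of tenth powers is a quadrature
formula for \<open>F\<close> whose nodes are the points. The first three terms of \<open>F\<close> live on the three lines that join
\<open>(1:0:0)\<close> to \<open>(0:1:1)\<close>, \<open>(0:1:-1)\<close> and \<open>(0:1:0)\<close>, and the last one on the line \<open>x = 0\<close>. The binary cubic that
cuts out the three directions is \<open>\<gamma> = z(z-y)(z+y)\<close>, and \<open>B(\<gamma>\<psi>)\<close> is four times the coefficient of \<open>y\<^sup>2z\<^sup>5\<close> in \<open>\<psi>\<close>.

Upper bound. The binary form \<open>y\<^sup>2z\<^sup>5\<close> has rank six, so \<open>B\<close> agrees on the multiples of \<open>\<gamma>\<close> with a combination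
of the values at the six roots of a binary sextic \<open>\<Lambda>\<close>. The remaining part of \<open>B\<close> is a combination of the values at the three
directions, and together with the rest of \<open>F\<close> it is carried by \<open>5 + 5 + 6\<close> points on the three
concurrent lines. There is a family of possible choices for \<open>\<Lambda>\<close>.

Lower bound. Suppose that \<open>f\<close> has a decomposition, and subtract the nodes on \<open>x = 0\<close> from \<open>B\<close>. If the new
\<open>B\<close> vanishes on the multiples of \<open>\<gamma>\<close>, at least six nodes lie on \<open>x = 0\<close>, because \<open>y\<^sup>2z\<^sup>5\<close> has rank six, and the
nodes off \<open>x = 0\<close> impose at least \<open>1+2+3+3+3+3+1 = 16\<close> conditions. If it does not vanish there, the
nodes off \<open>x = 0\<close> impose at least \<open>20\<close> conditions, and \<open>22\<close> if at most one node lies on \<open>x = 0\<close>. Both counts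
come from \<open>points_off_line_bound\<close>, and \<open>rank_lower_bound\<close> combines them.

Hilbert functions. A sextic \<open>g\<close> through all 22 points restricts on \<open>x = 0\<close> to a multiple \<open>c\<Lambda>\<close> of \<open>\<Lambda>\<close>. The quadrature
formula, applied to \<open>x\<^sup>4 g\<close>, gives \<open>c (\<Lambda>(1,1) + \<Lambda>(1,-1)) = 0\<close>. If \<open>\<Lambda>(1,1) + \<Lambda>(1,-1)\<close> is not zero, then \<open>g\<close>
vanishes on \<open>x = 0\<close> and on the three lines (\<open>sextics_through_pts\<close>). For
\<open>\<Lambda>\<^sub>1 = z\<^sup>6 + y\<^sup>3z\<^sup>3 - y\<^sup>6\<close> that number is zero, and there is one more sextic; for \<open>\<Lambda>\<^sub>2 = z\<^sup>6 + y\<^sup>6\<close> it is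
not. Hence the two Hilbert functions differ in degree six.\<close>

section \<open>Linear systems and interpolation\<close>

lemma underdetermined_system:
  fixes a :: "'e \<Rightarrow> 'i \<Rightarrow> complex"
  assumes "finite E" "finite I" "card E < card I"
  shows "\<exists>x. (\<exists>i\<in>I. x i \<noteq> 0) \<and> (\<forall>e\<in>E. (\<Sum>i\<in>I. a e i * x i) = 0)"
  using assms
proof (induction E arbitrary: I a rule: finite_induct)
  case empty
  then obtain i where "i \<in> I" by fastforce
  then show ?case by (intro exI[of _ "\<lambda>_. 1"]) auto
next
  case (insert e E)
  show ?case
  proof (cases "\<exists>k\<in>I. a e k \<noteq> 0")
    case False
    have "card E < card I" using insert.prems insert.hyps by simp
    then obtain x where "\<exists>i\<in>I. x i \<noteq> 0" "\<forall>e\<in>E. (\<Sum>i\<in>I. a e i * x i) = 0"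
      using insert.IH[OF insert.prems(1)] by blast
    with False show ?thesis by (intro exI[of _ x]) auto
  next
    case True
    then obtain k where k: "k \<in> I" "a e k \<noteq> 0" by blast
    define J where "J = I - {k}"
    have I: "I = insert k J" "k \<notin> J" "finite J" using k insert.prems by (auto simp: J_def)
    define b where "b e' i = a e' i - a e' k * a e i / a e k" for e' i
    have "card E < card J" using insert.prems insert.hyps I by simp
    then obtain x where x: "\<exists>i\<in>J. x i \<noteq> 0" "\<forall>e'\<in>E. (\<Sum>i\<in>J. b e' i * x i) = 0"
      using insert.IH[OF \<open>finite J\<close>] by blast
    define y where "y = x(k := - (\<Sum>i\<in>J. a e i * x i) / a e k)"
    have yJ: "(\<Sum>i\<in>J. a e' i * y i) = (\<Sum>i\<in>J. a e' i * x i)" for e'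
      using I by (intro sum.cong) (auto simp: y_def)
    have sumI: "(\<Sum>i\<in>I. a e' i * y i) = a e' k * y k + (\<Sum>i\<in>J. a e' i * x i)" for e'
      using I yJ by simp
    have "(\<Sum>i\<in>I. a e i * y i) = 0"
      using k unfolding sumI by (simp add: y_def)
    moreover have "(\<Sum>i\<in>I. a e' i * y i) = 0" if "e' \<in> E" for e'
    proof -
      have "0 = (\<Sum>i\<in>J. a e' i * x i) - (\<Sum>i\<in>J. a e' k * a e i / a e k * x i)"
        using x(2) that by (simp add: b_def algebra_simps sum_subtractf)
      also have "(\<Sum>i\<in>J. a e' k * a e i / a e k * x i) = a e' k / a e k * (\<Sum>i\<in>J. a e i * x i)"
        by (simp add: sum_distrib_left mult_ac)
      finally show ?thesis unfolding sumI by (simp add: y_def)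
    qed
    moreover have "\<exists>i\<in>I. y i \<noteq> 0"
      using x(1) I by (auto simp: y_def)
    ultimately show ?thesis by (intro exI[of _ y]) auto
  qed
qed

section \<open>Binary forms as univariate polynomials\<close>

text \<open>A binary form of degree \<open>d\<close> in \<open>y, z\<close> is represented by its dehomogenization \<open>p\<close> at \<open>y = 1\<close>, a polynomial of
degree at most \<open>d\<close>. Since \<open>p\<close> does not determine \<open>d\<close>, the degree of the form is an argument.\<close>

definition hom_eval :: "nat \<Rightarrow> complex poly \<Rightarrow> complex \<Rightarrow> complex \<Rightarrow> complex" where
  "hom_eval d p y z = (\<Sum>j\<le>d. coeff p j * y ^ (d - j) * z ^ j)"

lemma hom_eval_dehomogenize:
  assumes "degree p \<le> d" "y \<noteq> 0"
  shows "hom_eval d p y z = y ^ d * poly p (z / y)"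
proof -
  have "poly p (z / y) = (\<Sum>j\<le>d. coeff p j * (z / y) ^ j)"
    unfolding poly_altdef using assms(1)
    by (intro sum.mono_neutral_left) (auto simp: coeff_eq_0)
  then show ?thesis
    using assms(2)
    by (auto simp: hom_eval_def sum_distrib_left power_divide power_diff intro!: sum.cong)
qed

lemma hom_eval_at_0:
  "hom_eval d p 0 z = coeff p d * z ^ d"
proof -
  have "hom_eval d p 0 z = (\<Sum>j\<le>d. if j = d then coeff p d * z ^ d else 0)"
    unfolding hom_eval_def by (intro sum.cong) (auto simp: zero_power)
  then show ?thesis by simp
qed

lemma hom_eval_at_1: "degree p \<le> d \<Longrightarrow> hom_eval d p 1 z = poly p z"
  by (simp add: hom_eval_dehomogenize)

lemma coeff_mult_at_degree_bounds:
  fixes p q :: "complex poly"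
  assumes "degree p \<le> d" "degree q \<le> e"
  shows "coeff (p * q) (d + e) = coeff p d * coeff q e"
proof (cases "degree p = d \<and> degree q = e")
  case True
  then show ?thesis using coeff_mult_degree_sum[of p q] by simp
next
  case False
  then have "degree p < d \<or> degree q < e" using assms by auto
  moreover from this have "degree (p * q) < d + e"
    using degree_mult_le[of p q] assms by linarith
  ultimately show ?thesis by (auto simp: coeff_eq_0)
qed

lemma hom_eval_mult:
  assumes "degree p \<le> d" "degree q \<le> e"
  shows "hom_eval (d + e) (p * q) y z = hom_eval d p y z * hom_eval e q y z"
proof (cases "y = 0")
  case True
  then show ?thesis
    using coeff_mult_at_degree_bounds[OF assms] by (simp add: hom_eval_at_0 power_add)
next
  case False
  have "degree (p * q) \<le> d + e" using degree_mult_le[of p q] assms by linarith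
  then show ?thesis using False assms by (simp add: hom_eval_dehomogenize power_add)
qed

lemma hom_eval_add: "hom_eval d (p + q) y z = hom_eval d p y z + hom_eval d q y z"
  by (simp add: hom_eval_def algebra_simps sum.distrib)

lemma hom_eval_smult: "hom_eval d (smult c p) y z = c * hom_eval d p y z"
  by (simp add: hom_eval_def sum_distrib_left mult_ac)

lemma hom_eval_0: "hom_eval d 0 y z = 0"
  by (simp add: hom_eval_def)

lemma hom_eval_sum: "hom_eval d (\<Sum>i\<in>A. p i) y z = (\<Sum>i\<in>A. hom_eval d (p i) y z)"
  by (induction A rule: infinite_finite_induct) (auto simp: hom_eval_0 hom_eval_add)

lemma card_roots_rsquarefree:
  fixes p :: "complex poly"
  assumes "rsquarefree p"
  shows "card {z. poly p z = 0} = degree p"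
proof -
  have "p \<noteq> 0" using assms by (auto simp: rsquarefree_def)
  have "degree p = degree (smult (lead_coeff p) (\<Prod>z | poly p z = 0. [:- z, 1:]))"
    by (simp only: complex_poly_decompose_rsquarefree[OF assms])
  also have "\<dots> = (\<Sum>z | poly p z = 0. degree [:- z, 1:])"
    using \<open>p \<noteq> 0\<close> by (simp add: degree_prod_eq_sum_degree)
  finally show ?thesis by simp
qed

text \<open>Lagrange interpolation at the roots of \<open>q\<close> realizes the first \<open>degree q\<close> terms of any sequence as moments; both
the given sequence and the sequence of moments of a measure on the roots obey the recurrence with
characteristic polynomial \<open>q\<close>, so they agree as long as the recurrence holds. This is how apolar ideals
produce decompositions of binary forms.\<close>

lemma interpolation_by_recurrence:
  fixes q :: "complex poly" and \<mu> :: "nat \<Rightarrow> complex"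
  assumes q: "q \<noteq> 0" "rsquarefree q"
    and rec: "\<And>k. k + degree q \<le> N \<Longrightarrow> (\<Sum>i\<le>degree q. coeff q i * \<mu> (k + i)) = 0"
  shows "\<exists>c. \<forall>k\<le>N. (\<Sum>\<xi> | poly q \<xi> = 0. c \<xi> * \<xi> ^ k) = \<mu> k"
proof -
  define R where "R = {\<xi>. poly q \<xi> = 0}"
  define n where "n = degree q"
  have R: "finite R" "card R = n"
    using q poly_roots_finite card_roots_rsquarefree by (auto simp: R_def n_def)
  define e where "e \<xi> = (\<Prod>\<eta>\<in>R - {\<xi>}. smult (inverse (\<xi> - \<eta>)) [:- \<eta>, 1:])" for \<xi>
  have e_root: "poly (e \<xi>) \<eta> = (if \<xi> = \<eta> then 1 else 0)" if "\<xi> \<in> R" "\<eta> \<in> R" for \<xi> \<eta>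
  proof (cases "\<xi> = \<eta>")
    case True
    then have "poly (e \<xi>) \<eta> = (\<Prod>\<eta>'\<in>R - {\<xi>}. inverse (\<xi> - \<eta>') * (\<xi> - \<eta>'))"
      by (simp add: e_def poly_prod algebra_simps)
    also have "\<dots> = 1" by (intro prod.neutral ballI left_inverse) auto
    finally show ?thesis using True by simp
  next
    case False
    then show ?thesis using that R by (auto simp: e_def poly_prod prod_zero_iff)
  qed
  have e_deg: "degree (e \<xi>) < n" if "\<xi> \<in> R" for \<xi>
  proof -
    have "degree (e \<xi>) \<le> (\<Sum>\<eta>\<in>R - {\<xi>}. degree (smult (inverse (\<xi> - \<eta>)) [:- \<eta>, 1:]))"
      unfolding e_def using R degree_prod_sum_le[of "R - {\<xi>}" "\<lambda>\<eta>. smult (inverse (\<xi> - \<eta>)) [:- \<eta>, 1:]"]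
      by (simp only: o_def finite_Diff)
    also have "\<dots> \<le> (\<Sum>\<eta>\<in>R - {\<xi>}. 1)" by (intro sum_mono) simp
    also have "\<dots> = card (R - {\<xi>})" by simp
    also have "\<dots> < card R" using R(1) that by (rule card_Diff1_less)
    also have "card R = n" by (rule R(2))
    finally show ?thesis .
  qed
  define c where "c \<xi> = (\<Sum>j<n. coeff (e \<xi>) j * \<mu> j)" for \<xi>
  have interp: "(\<Sum>\<xi>\<in>R. smult (\<xi> ^ k) (e \<xi>)) = monom 1 k" if "k < n" for k
  proof -
    have "poly ((\<Sum>\<xi>\<in>R. smult (\<xi> ^ k) (e \<xi>)) - monom 1 k) \<eta> = 0" if "\<eta> \<in> R" for \<eta>
    proof -
      have "(\<Sum>\<xi>\<in>R. \<xi> ^ k * poly (e \<xi>) \<eta>) = (\<Sum>\<xi>\<in>R. if \<xi> = \<eta> then \<eta> ^ k else 0)"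
        using that by (intro sum.cong) (auto simp: e_root)
      also have "\<dots> = \<eta> ^ k" using that R by simp
      finally show ?thesis by (simp add: poly_sum poly_monom)
    qed
    moreover have "degree ((\<Sum>\<xi>\<in>R. smult (\<xi> ^ k) (e \<xi>)) - monom 1 k) < n"
      using that e_deg
      by (intro degree_diff_less degree_sum_less) (auto simp: degree_monom_eq intro: le_less_trans[OF degree_smult_le])
    ultimately have "(\<Sum>\<xi>\<in>R. smult (\<xi> ^ k) (e \<xi>)) - monom 1 k = 0"
      using R by (intro poly_eqI_degree[of R]) auto
    then show ?thesis by simp
  qed
  have "(\<Sum>\<xi>\<in>R. c \<xi> * \<xi> ^ k) = \<mu> k" if "k \<le> N" for k
    using that
  proof (induction k rule: less_induct)
    case (less k)
    show ?case
    proof (cases "k < n")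
      case True
      have "(\<Sum>\<xi>\<in>R. c \<xi> * \<xi> ^ k) = (\<Sum>j<n. \<mu> j * coeff (\<Sum>\<xi>\<in>R. smult (\<xi> ^ k) (e \<xi>)) j)"
        unfolding c_def coeff_sum sum_distrib_right sum_distrib_left
        by (subst sum.swap) (simp add: mult_ac)
      also have "\<dots> = (\<Sum>j<n. if j = k then \<mu> k else 0)"
        by (intro sum.cong) (auto simp: interp[OF True])
      finally show ?thesis using True by simp
    next
      case False
      define l where "l = k - n"
      have k: "k = l + n" using False by (simp add: l_def)
      have lead: "coeff q n \<noteq> 0" using q by (simp add: n_def)
      have IH: "(\<Sum>\<xi>\<in>R. c \<xi> * \<xi> ^ (l + i)) = \<mu> (l + i)" if "i < n" for i
        using less that k by simp
      have "0 = (\<Sum>\<xi>\<in>R. c \<xi> * \<xi> ^ l * poly q \<xi>)" by (simp add: R_def)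
      also have "\<dots> = (\<Sum>i\<le>n. coeff q i * (\<Sum>\<xi>\<in>R. c \<xi> * \<xi> ^ (l + i)))"
        unfolding poly_altdef n_def[symmetric] sum_distrib_left
        by (subst sum.swap) (simp add: mult_ac power_add)
      also have "\<dots> = (\<Sum>i<n. coeff q i * \<mu> (l + i)) + coeff q n * (\<Sum>\<xi>\<in>R. c \<xi> * \<xi> ^ k)"
        by (simp add: IH lessThan_Suc_atMost[symmetric] k)
      finally have eq: "0 = (\<Sum>i<n. coeff q i * \<mu> (l + i)) + coeff q n * (\<Sum>\<xi>\<in>R. c \<xi> * \<xi> ^ k)" .
      have "coeff q n * (\<Sum>\<xi>\<in>R. c \<xi> * \<xi> ^ k) = coeff q n * \<mu> k"
      proof -
        have "0 = (\<Sum>i<n. coeff q i * \<mu> (l + i)) + coeff q n * \<mu> k"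
          using rec[of l] less.prems k by (simp add: n_def[symmetric] lessThan_Suc_atMost[symmetric])
        with eq show ?thesis by (metis add_left_cancel)
      qed
      then show ?thesis using lead by simp
    qed
  qed
  then show ?thesis unfolding R_def by blast
qed

lemma poly_zero_of_three_roots:
  fixes p :: "complex poly"
  assumes "degree p \<le> 2" "poly p 1 = 0" "poly p (-1) = 0" "poly p 0 = 0"
  shows "p = 0"
  using assms by (intro poly_eqI_degree[of "{1, -1, 0}"]) auto

section \<open>Counting points off a line\<close>

text \<open>The dehomogenization of \<open>\<gamma> = z(z-y)(z+y)\<close>.\<close>

definition cubic :: "complex poly" where "cubic = [:0, -1, 0, 1:]"

lemma poly_cubic: "poly cubic t = t ^ 3 - t"
  by (simp add: cubic_def algebra_simps power3_eq_cube)

lemma degree_cubic: "degree cubic = 3"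
  by (simp add: cubic_def)

lemma sum_split_shift:
  fixes f :: "nat \<Rightarrow> 'a :: comm_monoid_add"
  shows "(\<Sum>k<m + d. f k) = (\<Sum>k<m. f k) + (\<Sum>k<d. f (m + k))"
  by (induction d) (simp_all add: add.assoc)

text \<open>The functional \<open>F\<close> on \<open>x\<^bsup>10-k\<^esup>\<close> times a binary form of degree \<open>k\<close>, with an arbitrary functional \<open>B\<close> in
degree ten, so that points on \<open>x = 0\<close> can be absorbed into \<open>B\<close>.\<close>

definition moment_fun :: "(complex poly \<Rightarrow> complex) \<Rightarrow> nat \<Rightarrow> complex poly \<Rightarrow> complex" where
  "moment_fun B k p =
     (if k = 6 then poly p 1 + poly p (-1) else if k = 7 then poly p 0 else if k = 10 then B p else 0)"

text \<open>The forms \<open>\<Sum>\<^sub>i x\<^bsup>7-i\<^esup> g\<^sub>i(y,z)\<close>, with \<open>g\<^sub>i\<close> in the span of the first \<open>test_dim \<kappa> d i\<close> of the binary forms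
\<open>test_basis L e s (i, _)\<close>, are chosen to represent independent conditions on points off \<open>x = 0\<close>: in
degree \<open>i\<close> they meet trivially the restrictions to \<open>x = 0\<close> of the forms that vanish at such points. For \<open>\<kappa> = d = 0\<close> the dimensions
are \<open>1, 2, 3, 3, 3, 3, 1\<close>; a functional \<open>B\<close> that does not vanish on the multiples of \<open>\<gamma>\<close> makes further conditions
visible, symmetrically in the degrees \<open>3, 7\<close> and \<open>4, 6\<close>.\<close>

definition test_dim :: "nat \<Rightarrow> nat \<Rightarrow> nat \<Rightarrow> nat" where
  "test_dim \<kappa> d i = [1, 2, 3, 3 + \<kappa>, 3 + d, 3, 1 + d, \<kappa>] ! i"

definition test_basis ::
  "(nat \<Rightarrow> complex poly) \<Rightarrow> (nat \<Rightarrow> complex poly) \<Rightarrow> complex poly \<Rightarrow> nat \<times> nat \<Rightarrow> complex poly" where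
  "test_basis L e s = (\<lambda>(i, k).
     if i = 3 \<and> k = 3 then cubic
     else if i = 4 \<and> 3 \<le> k then L (k - 3) * cubic
     else if i = 6 \<and> 1 \<le> k then e (k - 1)
     else if i = 7 then s
     else monom 1 k)"

text \<open>If there were fewer points, some nonzero form \<open>\<Sum>\<^sub>i x\<^bsup>7-i\<^esup> g\<^sub>i\<close> of the test space would vanish at all of
them. Its components are shown to be zero from the top down: once \<open>g\<^sub>i\<close> is zero for \<open>i > m\<close>, the form can be
divided by \<open>x\<^bsup>7-m\<^esup>\<close>, multiplied by a suitable form, and summed over the points, and the moments then
yield equations for \<open>g\<^sub>m\<close>. The forms \<open>L\<^sub>j\<close> and \<open>e\<^sub>k\<close> are dual to each other for the pairing \<open>B(\<gamma> L\<^sub>j e\<^sub>k)\<close>; the condition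
on the values of \<open>e\<^sub>k\<close> at \<open>1\<close> and \<open>-1\<close> makes them invisible to the degree six part of \<open>F\<close>.\<close>

lemma points_off_line_bound:
  fixes B :: "complex poly \<Rightarrow> complex" and x y z :: "'i \<Rightarrow> complex"
  assumes "finite A" and x: "\<And>v. v \<in> A \<Longrightarrow> x v \<noteq> 0"
    and moments: "\<And>k p. k \<le> 10 \<Longrightarrow> degree p \<le> k \<Longrightarrow>
      (\<Sum>v\<in>A. x v ^ (10 - k) * hom_eval k p (y v) (z v)) = moment_fun B k p"
    and B_add: "\<And>p q. B (p + q) = B p + B q" and B_smult: "\<And>c p. B (smult c p) = c * B p"
    and \<kappa>: "\<kappa> \<le> 1" "\<kappa> = 1 \<Longrightarrow> degree s \<le> 7 \<and> B (cubic * s) \<noteq> 0"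
    and L: "\<And>j. j < d \<Longrightarrow> degree (L j) \<le> 1"
    and e: "\<And>j. j < d \<Longrightarrow> degree (e j) \<le> 6 \<and> poly (e j) 1 + poly (e j) (-1) = 0"
    and diag: "\<And>j k. j < d \<Longrightarrow> k < d \<Longrightarrow> (B (cubic * (L j * e k)) \<noteq> 0) = (j = k)"
  shows "16 + 2 * \<kappa> + 2 * d \<le> card A"
proof (rule ccontr)
  assume few: "\<not> 16 + 2 * \<kappa> + 2 * d \<le> card A"
  define I where "I = (SIGMA i:{..7}. {..<test_dim \<kappa> d i})"
  have "card I = (\<Sum>i\<le>7. test_dim \<kappa> d i)" by (simp add: I_def)
  also have "\<dots> = 16 + 2 * \<kappa> + 2 * d"
    by (simp add: test_dim_def eval_nat_numeral)
  finally have card_I: "card A < card I" using few by simp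
  have "finite I" by (simp add: I_def)
  let ?bas = "test_basis L e s"
  obtain c where c0: "\<exists>i\<in>I. c i \<noteq> 0"
    and c: "\<And>v. v \<in> A \<Longrightarrow> (\<Sum>i\<in>I. (x v ^ (7 - fst i) * hom_eval (fst i) (?bas i) (y v) (z v)) * c i) = 0"
    using underdetermined_system[OF \<open>finite A\<close> \<open>finite I\<close> card_I,
        of "\<lambda>v i. x v ^ (7 - fst i) * hom_eval (fst i) (?bas i) (y v) (z v)"] by blast
  define g where "g i = (\<Sum>k<test_dim \<kappa> d i. smult (c (i, k)) (?bas (i, k)))" for i
  have g_vanishes: "(\<Sum>i\<le>7. x v ^ (7 - i) * hom_eval i (g i) (y v) (z v)) = 0" if "v \<in> A" for v
  proof -
    have "(\<Sum>i\<le>7. x v ^ (7 - i) * hom_eval i (g i) (y v) (z v))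
        = (\<Sum>i\<le>7. \<Sum>k<test_dim \<kappa> d i. (x v ^ (7 - i) * hom_eval i (?bas (i, k)) (y v) (z v)) * c (i, k))"
      by (simp add: g_def hom_eval_sum hom_eval_smult sum_distrib_left mult_ac)
    also have "\<dots> = 0" using c[OF that] by (simp add: I_def sum.Sigma case_prod_unfold)
    finally show ?thesis .
  qed
  have deg_bas: "degree (?bas (i, k)) \<le> i" if "i \<le> 7" "k < test_dim \<kappa> d i" for i k
  proof -
    consider "i = 0" | "i = 1" | "i = 2" | "i = 3" | "i = 4" | "i = 5" | "i = 6" | "i = 7"
      using \<open>i \<le> 7\<close> by linarith
    then show ?thesis
    proof cases
      case 5
      have "degree (L (k - 3) * cubic) \<le> 4" if "k \<ge> 3"
      proof -
        have "k - 3 < d" using that 5 \<open>k < _\<close> by (simp add: test_dim_def)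
        from L[OF this] show ?thesis
          using degree_mult_le[of "L (k - 3)" cubic] degree_cubic by linarith
      qed
      then show ?thesis using 5 by (auto simp: test_basis_def degree_monom_eq)
    qed (use that \<kappa> e[of "k - 1"] degree_cubic in
        \<open>auto simp: test_basis_def test_dim_def degree_monom_eq less_Suc_eq eval_nat_numeral\<close>)
  qed
  have deg_g: "degree (g i) \<le> i" if "i \<le> 7" for i
    unfolding g_def using deg_bas[OF that]
    by (intro degree_sum_le) (auto intro: order.trans[OF degree_smult_le])
  \<comment> \<open>the products have degree at most ten after the division by a power of \<open>x\<close>, so the moments apply\<close>
  have test: "(\<Sum>j\<le>m. moment_fun B (j + r) (g j * q)) = 0"
    if m: "m + r \<le> 10" "m \<le> 7" and top: "\<forall>i\<in>{m<..7}. g i = 0" and q: "degree q \<le> r" for m r q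
  proof -
    have "(\<Sum>j\<le>m. moment_fun B (j + r) (g j * q))
        = (\<Sum>j\<le>m. \<Sum>v\<in>A. x v ^ (10 - (j + r)) * hom_eval (j + r) (g j * q) (y v) (z v))"
      using m q deg_g by (intro sum.cong[OF refl] moments[symmetric]) 
        (auto intro!: order.trans[OF degree_mult_le] add_mono)
    also have "\<dots> = (\<Sum>v\<in>A. \<Sum>j\<le>m. x v ^ (10 - (j + r)) * hom_eval (j + r) (g j * q) (y v) (z v))"
      by (rule sum.swap)
    also have "\<dots> = (\<Sum>v\<in>A. x v ^ (10 - m - r) * hom_eval r q (y v) (z v) *
                  (\<Sum>j\<le>m. x v ^ (m - j) * hom_eval j (g j) (y v) (z v)))"
      unfolding sum_distrib_left
    proof (intro sum.cong refl)
      fix v j assume "j \<in> {..m}"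
      then have "10 - (j + r) = (10 - m - r) + (m - j)" "degree (g j) \<le> j" using m deg_g by auto
      then show "x v ^ (10 - (j + r)) * hom_eval (j + r) (g j * q) (y v) (z v)
          = x v ^ (10 - m - r) * hom_eval r q (y v) (z v) * (x v ^ (m - j) * hom_eval j (g j) (y v) (z v))"
        using q by (simp only: power_add hom_eval_mult) (simp add: mult_ac)
    qed
    also have "\<dots> = 0"
    proof (intro sum.neutral ballI)
      fix v assume v: "v \<in> A"
      have "0 = (\<Sum>j\<le>7. x v ^ (7 - j) * hom_eval j (g j) (y v) (z v))" using g_vanishes[OF v] by simp
      also have "\<dots> = (\<Sum>j\<le>m. x v ^ (7 - j) * hom_eval j (g j) (y v) (z v))"
        using m top by (intro sum.mono_neutral_right) (auto simp: hom_eval_0)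
      also have "\<dots> = x v ^ (7 - m) * (\<Sum>j\<le>m. x v ^ (m - j) * hom_eval j (g j) (y v) (z v))"
        using m by (simp add: sum_distrib_left mult.assoc[symmetric] power_add[symmetric])
      finally show "x v ^ (10 - m - r) * hom_eval r q (y v) (z v) *
           (\<Sum>j\<le>m. x v ^ (m - j) * hom_eval j (g j) (y v) (z v)) = 0"
        using x[OF v] by simp
    qed
    finally show ?thesis .
  qed
  have B_0: "B 0 = 0" using B_smult[of 0 0] by simp
  have B_sum: "B (\<Sum>i\<in>J. f i) = (\<Sum>i\<in>J. B (f i))" for J :: "nat set" and f
    by (induction J rule: infinite_finite_induct) (auto simp: B_0 B_add)
  have sums: "(\<Sum>j\<le>7. f j) = f 0 + f 1 + f 2 + f 3 + f 4 + f 5 + f 6 + f 7"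
    "(\<Sum>j\<le>6. f j) = f 0 + f 1 + f 2 + f 3 + f 4 + f 5 + f 6"
    "(\<Sum>j\<le>5. f j) = f 0 + f 1 + f 2 + f 3 + f 4 + f 5"
    "(\<Sum>j\<le>4. f j) = f 0 + f 1 + f 2 + f 3 + f 4"
    "(\<Sum>j\<le>3. f j) = f 0 + f 1 + f 2 + f 3"
    "(\<Sum>j\<le>2. f j) = f 0 + f 1 + f 2" for f :: "nat \<Rightarrow> complex"
    by (simp_all add: eval_nat_numeral)
  note mf = moment_fun_def sums
  let ?\<alpha> = "[:-1, 0, 1:] :: complex poly"
  \<comment> \<open>the cubic vanishes in the three directions, so only the top component survives, in degree ten\<close>
  have g7: "g 7 = (\<Sum>k<\<kappa>. smult (c (7, k)) s)"
    by (simp add: g_def test_dim_def test_basis_def)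
  have "B (g 7 * cubic) = 0"
    using test[of 7 3 cubic] degree_cubic by (simp add: mf poly_cubic)
  then have c7: "c (7, k) = 0" if "k < \<kappa>" for k
    using \<kappa> that by (cases "\<kappa> = 1") (auto simp: g7 B_smult mult.commute)
  then have g7_0: "g 7 = 0" by (simp add: g7)
  have "{6<..7} = {7::nat}" by auto
  with g7_0 have top6: "\<forall>i\<in>{6<..7}. g i = 0" by simp
  \<comment> \<open>the multiplier 1 isolates the constant, after which the \<open>L\<^sub>j\<close> separate the \<open>e\<^sub>k\<close>\<close>
  have g6: "g 6 = [:c (6, 0):] + (\<Sum>k<d. smult (c (6, Suc k)) (e k))"
    by (simp add: g_def test_dim_def test_basis_def sum.lessThan_Suc_shift smult_monom monom_0
        del: sum.lessThan_Suc)
  have "poly (g 6) 1 + poly (g 6) (-1) = 0"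
    using test[of 6 0 1] top6 by (simp add: mf)
  then have "2 * c (6, 0) + (\<Sum>k<d. c (6, Suc k) * (poly (e k) 1 + poly (e k) (-1))) = 0"
    by (simp add: g6 poly_sum distrib_left sum.distrib)
  then have c60: "c (6, 0) = 0" using e by simp
  have c6: "c (6, Suc j) = 0" if "j < d" for j
  proof -
    have "B (g 6 * (cubic * L j)) = 0"
      using test[of 6 4 "cubic * L j"] top6 L[OF that] degree_mult_le[of cubic "L j"] degree_cubic
      by (simp add: mf poly_cubic)
    moreover have "g 6 * (cubic * L j) = (\<Sum>k<d. smult (c (6, Suc k)) (cubic * (L j * e k)))"
      by (simp add: g6 c60 sum_distrib_left mult_ac)
    ultimately have "(\<Sum>k<d. c (6, Suc k) * B (cubic * (L j * e k))) = 0"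
      by (simp add: B_sum B_smult)
    moreover have "(\<Sum>k<d. c (6, Suc k) * B (cubic * (L j * e k)))
        = (\<Sum>k<d. if k = j then c (6, Suc j) * B (cubic * (L j * e j)) else 0)"
      using diag[OF that] by (intro sum.cong) auto
    ultimately show ?thesis using that diag[of j j] by simp
  qed
  have g6_0: "g 6 = 0" by (simp add: g6 c60 c6)
  have "{5<..7} = {6, 7::nat}" by auto
  with g6_0 g7_0 have top5: "\<forall>i\<in>{5<..7}. g i = 0" by simp
  \<comment> \<open>a multiplier that vanishes at one of \<open>1, -1\<close> gives the value at the other one, and a multiplier
      that vanishes at both gives the value at \<open>0\<close>; the same is done in the lower degrees\<close>
  have mono_sum: "(\<Sum>k<3. smult (a k) (monom 1 k)) = [:a 0, a 1, a 2:]" for a :: "nat \<Rightarrow> complex"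
    by (simp add: eval_nat_numeral monom_altdef)
  have "g 5 = (\<Sum>k<3. smult (c (5, k)) (monom 1 k))"
    by (simp add: g_def test_dim_def test_basis_def)
  then have g5: "g 5 = [:c (5, 0), c (5, 1), c (5, 2):]"
    by (simp only: mono_sum)
  have "poly (g 5) (-1) = 0" using test[OF _ _ top5, of 1 "[:-1, 1:]"] by (simp add: mf)
  moreover have "poly (g 5) 1 = 0" using test[OF _ _ top5, of 1 "[:1, 1:]"] by (simp add: mf)
  moreover have "poly (g 5) 0 = 0" using test[OF _ _ top5, of 2 "?\<alpha>"] by (simp add: mf)
  ultimately have g5_0: "g 5 = 0"
    by (intro poly_zero_of_three_roots) (simp_all add: g5)
  have "{4<..7} = {5, 6, 7::nat}" by auto
  with g5_0 g6_0 g7_0 have top4: "\<forall>i\<in>{4<..7}. g i = 0" by simp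
  have "(\<Sum>k<3 + d. smult (c (4, k)) (?bas (4, k)))
      = (\<Sum>k<3. smult (c (4, k)) (monom 1 k)) + (\<Sum>k<d. smult (c (4, 3 + k)) (L k * cubic))"
    by (simp add: sum_split_shift test_basis_def)
  then have g4: "g 4 = [:c (4, 0), c (4, 1), c (4, 2):] + (\<Sum>k<d. smult (c (4, 3 + k)) (L k * cubic))"
    by (simp add: g_def test_dim_def mono_sum)
  have "poly (g 4) (-1) = 0" using test[OF _ _ top4, of 2 "[:-1, 1:]"] by (simp add: mf)
  moreover have "poly (g 4) 1 = 0" using test[OF _ _ top4, of 2 "[:1, 1:]"] by (simp add: mf)
  moreover have "poly (g 4) 0 = 0" using test[OF _ _ top4, of 3 "?\<alpha>"] by (simp add: mf)
  ultimately have c4_low: "[:c (4, 0), c (4, 1), c (4, 2):] = 0"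
    by (intro poly_zero_of_three_roots) (simp_all add: g4 poly_sum poly_cubic)
  have g4': "g 4 = (\<Sum>k<d. smult (c (4, 3 + k)) (L k * cubic))"
    unfolding g4 c4_low by simp
  \<comment> \<open>a sextic multiplier also meets \<open>g\<^sub>0\<close> in degree six and \<open>g\<^sub>1\<close> in degree seven, so \<open>g\<^sub>1\<close> is removed first;
      \<open>g\<^sub>0\<close> drops out because \<open>e\<^sub>j\<close> is invisible in degree six\<close>
  have "poly (g 1) (-1) = 0" using test[OF _ _ top4, of 5 "[:0, -1, 1:]"] by (simp add: mf)
  moreover have "poly (g 1) 1 = 0" using test[OF _ _ top4, of 5 "[:0, 1, 1:]"] by (simp add: mf)
  ultimately have g1_0: "g 1 = 0"
    using deg_g[of 1] by (intro poly_eqI_degree[of "{1, -1}"]) auto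
  then have g1_Suc: "g (Suc 0) = 0" by simp
  have c4: "c (4, 3 + j) = 0" if "j < d" for j
  proof -
    have "poly (g 0 * e j) 1 + poly (g 0 * e j) (-1) + B (g 4 * e j) = 0"
      using test[OF _ _ top4, of 6 "e j"] e[OF that] by (simp add: mf g1_Suc)
    moreover obtain b where "g 0 = [:b:]" using deg_g[of 0] by (auto elim: degree_eq_zeroE)
    ultimately have "B (g 4 * e j) = 0" using e[OF that] by (simp add: distrib_left[symmetric])
    moreover have "g 4 * e j = (\<Sum>k<d. smult (c (4, 3 + k)) (cubic * (L k * e j)))"
      by (simp add: g4' sum_distrib_left sum_distrib_right mult_ac)
    ultimately have "(\<Sum>k<d. c (4, 3 + k) * B (cubic * (L k * e j))) = 0"
      by (simp add: B_sum B_smult)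
    moreover have "(\<Sum>k<d. c (4, 3 + k) * B (cubic * (L k * e j)))
        = (\<Sum>k<d. if k = j then c (4, 3 + j) * B (cubic * (L j * e j)) else 0)"
      using diag[OF _ that] by (intro sum.cong) auto
    ultimately show ?thesis using that diag[of j j] by simp
  qed
  have g4_0: "g 4 = 0" by (simp add: g4' c4)
  have "{3<..7} = {4, 5, 6, 7::nat}" by auto
  with g4_0 g5_0 g6_0 g7_0 have top3: "\<forall>i\<in>{3<..7}. g i = 0" by simp
  have "(\<Sum>k<3 + \<kappa>. smult (c (3, k)) (?bas (3, k)))
      = (\<Sum>k<3. smult (c (3, k)) (monom 1 k)) + (\<Sum>k<\<kappa>. smult (c (3, 3 + k)) cubic)"
    using \<kappa>(1) by (simp add: sum_split_shift test_basis_def)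
  then have g3: "g 3 = [:c (3, 0), c (3, 1), c (3, 2):] + (\<Sum>k<\<kappa>. smult (c (3, 3 + k)) cubic)"
    by (simp add: g_def test_dim_def mono_sum)
  have "poly (g 3) (-1) = 0" using test[OF _ _ top3, of 3 "[:-1, 1:]"] by (simp add: mf)
  moreover have "poly (g 3) 1 = 0" using test[OF _ _ top3, of 3 "[:1, 1:]"] by (simp add: mf)
  moreover have "poly (g 3) 0 = 0" using test[OF _ _ top3, of 4 "?\<alpha>"] by (simp add: mf)
  ultimately have c3_low: "[:c (3, 0), c (3, 1), c (3, 2):] = 0"
    by (intro poly_zero_of_three_roots) (simp_all add: g3 poly_sum poly_cubic)
  have g3': "g 3 = (\<Sum>k<\<kappa>. smult (c (3, 3 + k)) cubic)"
    unfolding g3 c3_low by simp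
  have "poly (g 0) 1 + poly (g 0) (-1) = 0"
    using test[OF _ _ top3, of 6 1] by (simp add: mf g1_Suc)
  then have g0_0: "g 0 = 0" using deg_g[of 0] by (auto elim!: degree_eq_zeroE)
  have c3: "c (3, 3 + k) = 0" if "k < \<kappa>" for k
  proof -
    have "\<kappa> = 1" "k = 0" using \<kappa>(1) that by auto
    then have "B (g 3 * s) = 0"
      using test[OF _ _ top3, of 7 s] \<kappa> by (simp add: mf g0_0)
    then show ?thesis using \<kappa> \<open>\<kappa> = 1\<close> \<open>k = 0\<close> by (simp add: g3' B_smult)
  qed
  have g3_0: "g 3 = 0" by (simp add: g3' c3)
  have "{2<..7} = {3, 4, 5, 6, 7::nat}" by auto
  with g3_0 g4_0 g5_0 g6_0 g7_0 have top2: "\<forall>i\<in>{2<..7}. g i = 0" by simp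
  have "poly (g 2) (-1) = 0" using test[OF _ _ top2, of 4 "[:-1, 1:]"] by (simp add: mf)
  moreover have "poly (g 2) 1 = 0" using test[OF _ _ top2, of 4 "[:1, 1:]"] by (simp add: mf)
  moreover have "poly (g 2) 0 = 0" using test[OF _ _ top2, of 5 "?\<alpha>"] by (simp add: mf g1_Suc)
  ultimately have g2_0: "g 2 = 0"
    using deg_g[of 2] by (intro poly_zero_of_three_roots) auto
  have coeff_mono: "coeff (\<Sum>k<n. smult (a k) (monom 1 k)) j = (if j < n then a j else 0)"
    for a :: "nat \<Rightarrow> complex" and n j
    by (simp add: coeff_sum if_distrib[of "\<lambda>x. _ * x"] cong: if_cong)
  have c_low: "c (i, k) = 0" if "i < 3" "k < Suc i" for i k
  proof -
    have "g i = (\<Sum>k<Suc i. smult (c (i, k)) (monom 1 k))"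
      using \<open>i < 3\<close> unfolding g_def
      by (intro sum.cong) (auto simp: test_dim_def test_basis_def less_Suc_eq eval_nat_numeral)
    moreover have "g i = 0" using \<open>i < 3\<close> g0_0 g1_0 g2_0 by (auto simp: less_Suc_eq eval_nat_numeral)
    ultimately show ?thesis using coeff_mono[where n = "Suc i" and a = "\<lambda>k. c (i, k)" and j = k] that
      by (simp del: sum.lessThan_Suc)
  qed
  have c_3: "c (i, k) = 0" if "i = 3 \<or> i = 4 \<or> i = 5" "k < 3" for i k
    using that c3_low c4_low g5_0 g5 by (auto simp: less_Suc_eq eval_nat_numeral)
  have "c (i, k) = 0" if "i \<le> 7" "k < test_dim \<kappa> d i" for i k
  proof -
    consider "i < 3" | "i = 3" | "i = 4" | "i = 5" | "i = 6" | "i = 7" using \<open>i \<le> 7\<close> by linarith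
    then show ?thesis
    proof cases
      case 1
      then show ?thesis using that c_low[of i k]
        by (auto simp: test_dim_def less_Suc_eq eval_nat_numeral)
    next
      case 2
      then show ?thesis using that c_3[of i k] c3[of "k - 3"] by (cases "k < 3") (auto simp: test_dim_def)
    next
      case 3
      then show ?thesis using that c_3[of i k] c4[of "k - 3"] by (cases "k < 3") (auto simp: test_dim_def)
    next
      case 4
      then show ?thesis using that c_3[of i k] by (auto simp: test_dim_def)
    next
      case 5
      then show ?thesis using that c60 c6 by (cases k) (auto simp: test_dim_def)
    next
      case 6
      then show ?thesis using that c7 by (auto simp: test_dim_def)
    qed
  qed
  then show False using c0 by (auto simp: I_def)
qed

section \<open>Twenty-two points are necessary\<close>

text \<open>The value of \<open>F\<close> at the monomial \<open>x\<^bsup>10-k\<^esup> y\<^bsup>k-j\<^esup> z\<^sup>j\<close>, that is, the coefficient of this monomial in \<open>f\<close> divided by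
its multinomial coefficient.\<close>

definition moment :: "nat \<Rightarrow> nat \<Rightarrow> complex" where
  "moment k j =
     (if k = 6 then 1 + (-1) ^ j
      else if k = 7 then (if j = 0 then 1 else 0)
      else if k = 10 then (if j = 8 \<or> j = 10 then 4 else 0)
      else 0)"

lemma moment_fun_of_moments:
  assumes "degree p \<le> k" "k \<noteq> 10"
  shows "(\<Sum>j\<le>k. coeff p j * moment k j) = moment_fun B k p"
proof -
  have "(\<Sum>j\<le>6. coeff p j * (1 + (-1) ^ j)) = poly p 1 + poly p (-1)" if "degree p \<le> 6"
    using that by (simp add: hom_eval_at_1[symmetric] hom_eval_def sum.distrib[symmetric] distrib_left)
  moreover have "(\<Sum>j\<le>7. coeff p j * (if j = 0 then 1 else 0)) = poly p 0"
    by (simp add: poly_0_coeff_0 if_distrib[of "\<lambda>x. _ * x"] cong: if_cong)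
  ultimately show ?thesis using assms by (simp add: moment_fun_def moment_def)
qed

text \<open>Multiplication by \<open>\<gamma>\<close> telescopes: the coefficients of index 8 and 10 of \<open>\<gamma>\<psi>\<close> add up to the coefficient of index 5
of a septic \<open>\<psi>\<close>.\<close>

lemma coeff_cubic_mult: "coeff (cubic * p) (n + 3) = coeff p n - coeff p (n + 2)"
proof -
  have c: "cubic = monom 1 3 - monom 1 1"
    by (simp add: cubic_def monom_altdef eval_nat_numeral)
  have "coeff (cubic * p) (n + 3) = coeff (monom 1 3 * p) (n + 3) - coeff (monom 1 1 * p) (n + 3)"
    unfolding c by (metis coeff_diff left_diff_distrib)
  then show ?thesis by (simp add: coeff_monom_mult)
qed

text \<open>Test forms \<open>e\<^sub>0, e\<^sub>1\<close> dual to \<open>L\<^sub>0 = y\<close> and \<open>L\<^sub>1 = z\<close> that, in addition, vanish at one prescribed point of the line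
\<open>x = 0\<close>. Both are multiples of \<open>(z\<^sup>2 - y\<^sup>2)(z - wy)\<close>, with \<open>w\<close> the slope of the point, or of \<open>y(z\<^sup>2 - y\<^sup>2)\<close> if the
point is \<open>(0:1)\<close>.\<close>

lemma diagonal_test_forms:
  fixes y z :: complex
  shows "\<exists>e :: nat \<Rightarrow> complex poly.
    (\<forall>k. degree (e k) \<le> 6 \<and> poly (e k) 1 + poly (e k) (-1) = 0 \<and> hom_eval 6 (e k) y z = 0) \<and>
    coeff (e 0) 5 = 1 \<and> coeff (e 0) 4 = 0 \<and> coeff (e 1) 5 = 0 \<and> coeff (e 1) 4 = 1"
proof (cases "y = 0")
  case True
  show ?thesis
    by (rule exI[of _ "\<lambda>k. if k = 0 then [:0, 0, 0, -1, 0, 1:] else [:0, 0, -1, 0, 1:]"])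
      (auto simp: True hom_eval_at_0 eval_nat_numeral)
next
  case False
  define w where "w = z / y"
  show ?thesis
    by (rule exI[of _ "\<lambda>k. if k = 0 then [:0, w\<^sup>2, 0, - (1 + w\<^sup>2), 0, 1:] else [:0, w, -1, - w, 1:]"])
      (use False in \<open>auto simp: hom_eval_dehomogenize w_def[symmetric] eval_nat_numeral algebra_simps\<close>)
qed

text \<open>Let \<open>n\<close> be the number of points on \<open>x = 0\<close>, and let \<open>S(\<psi>) = B(\<gamma>\<psi>)\<close> after these points have been subtracted
from \<open>B\<close>. If \<open>S\<close> is zero, the points on \<open>x = 0\<close> decompose \<open>y\<^sup>2z\<^sup>5\<close>, so \<open>n\<close> is at least six, and at least 16 points lie
off the line. If \<open>S\<close> is nonzero, there is at least one dual pair of test forms, and at least 20 points lie off the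
line; for \<open>n \<le> 1\<close> there are two dual pairs, and at least 22 points lie off the line.\<close>

lemma rank_lower_bound:
  fixes x y z :: "'i \<Rightarrow> complex"
  assumes "finite A"
    and moments: "\<And>k j. j \<le> k \<Longrightarrow> k \<le> 10 \<Longrightarrow>
      (\<Sum>v\<in>A. x v ^ (10 - k) * y v ^ (k - j) * z v ^ j) = moment k j"
  shows "22 \<le> card A"
proof -
  define A1 where "A1 = {v\<in>A. x v \<noteq> 0}"
  define A0 where "A0 = {v\<in>A. x v = 0}"
  have A: "A = A1 \<union> A0" "A1 \<inter> A0 = {}" "finite A1" "finite A0"
    using \<open>finite A\<close> by (auto simp: A1_def A0_def)
  then have card_A: "card A = card A1 + card A0" by (simp add: card_Un_disjoint)
  define B where "B p = (\<Sum>j\<le>10. coeff p j * moment 10 j) - (\<Sum>v\<in>A0. hom_eval 10 p (y v) (z v))" for p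
  have B_add: "B (p + q) = B p + B q" for p q
    by (simp add: B_def hom_eval_add sum.distrib distrib_right)
  have B_smult: "B (smult c p) = c * B p" for c p
    by (simp add: B_def hom_eval_smult sum_distrib_left right_diff_distrib mult_ac)
  have A1_moments: "(\<Sum>v\<in>A1. x v ^ (10 - k) * hom_eval k p (y v) (z v)) = moment_fun B k p"
    if k: "k \<le> 10" "degree p \<le> k" for k p
  proof -
    have "(\<Sum>v\<in>A. x v ^ (10 - k) * hom_eval k p (y v) (z v))
        = (\<Sum>j\<le>k. coeff p j * (\<Sum>v\<in>A. x v ^ (10 - k) * y v ^ (k - j) * z v ^ j))"
      unfolding hom_eval_def sum_distrib_left by (subst sum.swap) (simp add: mult_ac)
    also have "\<dots> = (\<Sum>j\<le>k. coeff p j * moment k j)"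
      using k by (simp add: moments)
    finally have "(\<Sum>v\<in>A1. x v ^ (10 - k) * hom_eval k p (y v) (z v))
        = (\<Sum>j\<le>k. coeff p j * moment k j) - (\<Sum>v\<in>A0. x v ^ (10 - k) * hom_eval k p (y v) (z v))"
      using A by (simp add: sum.union_disjoint eq_diff_eq)
    also have "\<dots> = moment_fun B k p"
    proof (cases "k = 10")
      case True
      then show ?thesis by (simp add: moment_fun_def B_def)
    next
      case False
      then have "(\<Sum>v\<in>A0. x v ^ (10 - k) * hom_eval k p (y v) (z v)) = 0"
        using k by (intro sum.neutral) (auto simp: A0_def)
      then show ?thesis using moment_fun_of_moments[OF k(2) False] by simp
    qed
    finally show ?thesis .
  qed
  have S: "B (cubic * p) = 4 * coeff p 5 - (\<Sum>v\<in>A0. hom_eval 3 cubic (y v) (z v) * hom_eval 7 p (y v) (z v))"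
    if "degree p \<le> 7" for p
  proof -
    have "(\<Sum>j\<le>10. coeff (cubic * p) j * moment 10 j)
        = (\<Sum>j\<in>{8, 10}. coeff (cubic * p) j * moment 10 j)"
      by (intro sum.mono_neutral_right) (auto simp: moment_def)
    also have "\<dots> = 4 * coeff p 5"
      using coeff_cubic_mult[of p 5] coeff_cubic_mult[of p 7] that
      by (simp add: moment_def coeff_eq_0)
    finally show ?thesis
      using hom_eval_mult[of cubic 3 p 7] that by (simp add: B_def degree_cubic)
  qed
  note bound = points_off_line_bound[OF \<open>finite A1\<close> _ A1_moments B_add B_smult]
  show ?thesis
  proof (cases "\<exists>s. degree s \<le> 7 \<and> B (cubic * s) \<noteq> 0")
    case False
    have "6 \<le> card A0"
    proof (rule ccontr)
      assume "\<not> 6 \<le> card A0"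
      \<comment> \<open>\<open>y\<^sup>2z\<^bsup>5-m\<^esup>\<close> times the product of the linear forms of the \<open>m\<close> points with nonzero \<open>y\<close>
          vanishes at all points but has a nonzero coefficient at \<open>y\<^sup>2z\<^sup>5\<close>\<close>
      define C where "C = {v\<in>A0. y v \<noteq> 0}"
      have C: "finite C" "card C \<le> 5"
        using A \<open>\<not> 6 \<le> card A0\<close> card_mono[of A0 C] by (auto simp: C_def)
      define q where "q = (\<Prod>v\<in>C. [:- z v, y v:])"
      define p where "p = monom 1 (5 - card C) * q"
      have "degree q = (\<Sum>v\<in>C. degree [:- z v, y v:])"
        unfolding q_def by (intro degree_prod_eq_sum_degree) (auto simp: C_def)
      also have "\<dots> = (\<Sum>v\<in>C. 1)" by (intro sum.cong) (auto simp: C_def)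
      finally have deg_q: "degree q = card C" by simp
      have "lead_coeff q = (\<Prod>v\<in>C. lead_coeff [:- z v, y v:])"
        unfolding q_def by (rule lead_coeff_prod)
      also have "\<dots> \<noteq> 0" using C by (auto simp: C_def prod_zero_iff)
      finally have "coeff p 5 \<noteq> 0"
        using C deg_q by (simp add: p_def coeff_monom_mult)
      moreover have deg_p: "degree p \<le> 5"
        using degree_mult_le[of "monom 1 (5 - card C)" q] C deg_q
        by (simp add: p_def degree_monom_eq)
      moreover have "hom_eval 7 p (y v) (z v) = 0" if "v \<in> A0" for v
      proof (cases "y v = 0")
        case True
        then show ?thesis using deg_p by (simp add: hom_eval_at_0 coeff_eq_0)
      next
        case False
        then have "v \<in> C" using that by (simp add: C_def)
        moreover have "poly [:- z v, y v:] (z v / y v) = 0" using False by simp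
        ultimately have "poly q (z v / y v) = 0"
          unfolding q_def poly_prod using C(1) by (metis (no_types, lifting) prod_zero)
        then have "poly p (z v / y v) = 0" by (simp add: p_def)
        then show ?thesis using False deg_p by (simp add: hom_eval_dehomogenize)
      qed
      ultimately show False using S[of p] False by simp
    qed
    moreover have "16 \<le> card A1"
      using bound[of 0 0 0] by (simp add: A1_def)
    ultimately show ?thesis using card_A by linarith
  next
    case True
    then obtain s where s: "degree s \<le> 7" "B (cubic * s) \<noteq> 0" by blast
    show ?thesis
    proof (cases "card A0 \<le> 1")
      case True
      obtain y0 z0 where yz: "\<And>v. v \<in> A0 \<Longrightarrow> y v = y0 \<and> z v = z0"
        using True card_le_Suc0_iff_eq[OF \<open>finite A0\<close>] by (metis One_nat_def)
      obtain e :: "nat \<Rightarrow> complex poly"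
        where e: "\<And>k. degree (e k) \<le> 6 \<and> poly (e k) 1 + poly (e k) (-1) = 0"
          "\<And>k. hom_eval 6 (e k) y0 z0 = 0"
          "coeff (e 0) 5 = 1" "coeff (e 0) 4 = 0" "coeff (e 1) 5 = 0" "coeff (e 1) 4 = 1"
        using diagonal_test_forms[of y0 z0] by blast
      define L :: "nat \<Rightarrow> complex poly" where "L j = (if j = 0 then 1 else [:0, 1:])" for j
      have SLe: "B (cubic * (L j * e k)) = 4 * coeff (L j * e k) 5" for j k
      proof -
        have L: "degree (L j) \<le> 1" by (simp add: L_def)
        have "hom_eval (1 + 6) (L j * e k) (y v) (z v) = 0" if "v \<in> A0" for v
          using e(1)[of k] e(2)[of k] yz[OF that] L by (subst hom_eval_mult) auto
        moreover have "degree (L j * e k) \<le> 7"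
          using degree_mult_le[of "L j" "e k"] L e(1)[of k] by linarith
        ultimately show ?thesis by (simp add: S)
      qed
      have "16 + 2 * 1 + 2 * 2 \<le> card A1"
      proof (rule bound)
        show "(B (cubic * (L j * e k)) \<noteq> 0) = (j = k)" if "j < 2" "k < 2" for j k
        proof -
          have "coeff (L j * e k) 5 = (if j = 0 then coeff (e k) 5 else coeff (e k) 4)"
            by (simp add: L_def coeff_pCons)
          moreover have "j = 0 \<or> j = 1" "k = 0 \<or> k = 1" using that by auto
          ultimately show ?thesis using e unfolding SLe by auto
        qed
        show "degree (L j) \<le> 1" for j by (simp add: L_def)
      qed (use s e in \<open>auto simp: A1_def\<close>)
      then show ?thesis using card_A by linarith
    next
      case False
      \<comment> \<open>the products of a linear form with the sextics invisible in degree six span all septics\<close>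
      have "\<exists>l e. degree l \<le> 1 \<and> degree e \<le> 6 \<and> poly e 1 + poly e (-1) = 0 \<and> B (cubic * (l * e)) \<noteq> 0"
      proof (rule ccontr)
        assume "\<not> ?thesis"
        then have no: "B (cubic * (l * e)) = 0"
          if "degree l \<le> 1" "degree e \<le> 6" "poly e 1 + poly e (-1) = 0" for l e
          using that by blast
        have odd: "B (cubic * monom 1 k) = 0 \<and> B (cubic * monom 1 (Suc k)) = 0" if "odd k" "k \<le> 6" for k
          using that no[of 1 "monom 1 k"] no[of "monom 1 1" "monom 1 k"]
          by (simp add: degree_monom_eq poly_monom mult_monom)
        have "monom 1 0 = 1 * (1 - monom 1 2) + (monom 1 2 :: complex poly)" by simp
        then have zero: "B (cubic * monom 1 0) = 0"
          using no[of 1 "1 - monom 1 2"] odd[of 1] B_add[of "cubic * (1 * (1 - monom 1 2))" "cubic * monom 1 2"]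
          by (simp add: degree_monom_eq poly_monom degree_diff_le distrib_left[symmetric] numeral_2_eq_2)
        have "monom 1 7 = monom 1 1 * (monom 1 6 - monom 1 4) + (monom 1 5 :: complex poly)"
          by (simp add: right_diff_distrib mult_monom)
        then have seven: "B (cubic * monom 1 7) = 0"
          using no[of "monom 1 1" "monom 1 6 - monom 1 4"] odd[of 5]
          by (simp add: distrib_left B_add degree_monom_eq poly_monom degree_diff_le)
        have mono: "B (cubic * monom 1 k) = 0" if "k \<le> 7" for k
        proof -
          have "k = 0 \<or> k = 7 \<or> odd k \<and> k \<le> 6 \<or> (\<exists>m. k = Suc m \<and> odd m \<and> m \<le> 6)"
            using that by presburger
          then show ?thesis using zero seven odd by blast
        qed
        have B_sum: "B (\<Sum>i\<in>J. f i) = (\<Sum>i\<in>J. B (f i))" for J :: "nat set" and f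
          using B_smult[of 0 0] by (induction J rule: infinite_finite_induct) (auto simp: B_add)
        have "cubic * s = (\<Sum>i\<le>degree s. smult (coeff s i) (cubic * monom 1 i))"
          by (subst poly_as_sum_of_monoms[of s, symmetric])
            (simp add: sum_distrib_left smult_monom mult_smult_right[symmetric] del: mult_smult_right)
        then have "B (cubic * s) = 0" using s mono by (simp add: B_sum B_smult)
        with s show False by simp
      qed
      then obtain l e where le: "degree l \<le> 1" "degree e \<le> 6" "poly e 1 + poly e (-1) = 0"
        "B (cubic * (l * e)) \<noteq> 0" by blast
      have "16 + 2 * 1 + 2 * 1 \<le> card A1"
        by (rule bound[of 1 s 1 "\<lambda>_. l" "\<lambda>_. e"]) (use s le in \<open>auto simp: A1_def\<close>)
      then show ?thesis using card_A False by linarith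
    qed
  qed
qed

section \<open>Ternary forms in coordinates\<close>

lemma UNIV_3: "(UNIV :: 3 set) = {0, 1, 2}"
proof -
  have "card {0, 1, 2 :: 3} = CARD(3)" by simp
  then have "{0, 1, 2 :: 3} = UNIV" by (intro card_subset_eq) auto
  then show ?thesis by simp
qed

lemma sum_UNIV_3: "(\<Sum>i\<in>UNIV. f (i :: 3)) = f 0 + f 1 + f 2" for f :: "3 \<Rightarrow> 'a :: comm_monoid_add"
  unfolding UNIV_3 by (simp add: add_ac)

lemma prod_UNIV_3: "(\<Prod>i\<in>UNIV. f (i :: 3)) = f 0 * f 1 * f 2" for f :: "3 \<Rightarrow> 'a :: comm_monoid_mult"
  unfolding UNIV_3 by (simp add: mult_ac)

definition mon :: "nat \<Rightarrow> nat \<Rightarrow> nat \<Rightarrow> monom3" where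
  "mon a b c = Poly_Mapping.single 0 a + Poly_Mapping.single 1 b + Poly_Mapping.single 2 c"

lemma lookup_mon [simp]:
  "Poly_Mapping.lookup (mon a b c) 0 = a"
  "Poly_Mapping.lookup (mon a b c) 1 = b"
  "Poly_Mapping.lookup (mon a b c) 2 = c"
  by (simp_all add: mon_def lookup_add lookup_single)

lemma mon_eq_iff [simp]: "mon a b c = mon a' b' c' \<longleftrightarrow> a = a' \<and> b = b' \<and> c = c'"
proof
  assume eq: "mon a b c = mon a' b' c'"
  have "Poly_Mapping.lookup (mon a b c) i = Poly_Mapping.lookup (mon a' b' c') i" for i
    by (simp only: eq)
  from this[of 0] this[of 1] this[of 2] show "a = a' \<and> b = b' \<and> c = c'" by simp
qed simp

lemma mon_surj: "mon (Poly_Mapping.lookup m 0) (Poly_Mapping.lookup m 1) (Poly_Mapping.lookup m 2) = m"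
proof (rule poly_mapping_eqI)
  fix i :: 3
  have "i \<in> (UNIV :: 3 set)" by (rule UNIV_I)
  then have "i = 0 \<or> i = 1 \<or> i = 2" unfolding UNIV_3 by simp
  then show "Poly_Mapping.lookup (mon (Poly_Mapping.lookup m 0) (Poly_Mapping.lookup m 1) (Poly_Mapping.lookup m 2)) i
      = Poly_Mapping.lookup m i" by (elim disjE) simp_all
qed

lemma mdeg_eq: "mdeg m = Poly_Mapping.lookup m 0 + Poly_Mapping.lookup m 1 + Poly_Mapping.lookup m 2"
  by (simp only: mdeg_def sum_UNIV_3)

lemma mon_add: "mon a b c + mon a' b' c' = mon (a + a') (b + b') (c + c')"
  by (simp add: mon_def single_add add_ac)

text \<open>The coefficients are indexed by the degree \<open>k\<close> in \<open>y, z\<close> and the exponent \<open>j\<close> of \<open>z\<close>, which matches the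
splitting of a ternary form into binary forms along \<open>x = 0\<close>.\<close>

definition ternary :: "nat \<Rightarrow> (nat \<Rightarrow> nat \<Rightarrow> complex) \<Rightarrow> poly3" where
  "ternary n h = (\<Sum>k\<le>n. \<Sum>j\<le>k. Poly_Mapping.single (mon (n - k) (k - j) j) (h k j))"

lemma lookup_ternary:
  assumes "j \<le> k" "k \<le> n"
  shows "Poly_Mapping.lookup (ternary n h) (mon (n - k) (k - j) j) = h k j"
proof -
  have "Poly_Mapping.lookup (ternary n h) (mon (n - k) (k - j) j)
      = (\<Sum>k'\<le>n. \<Sum>j'\<le>k'. if k' = k then (if j' = j then h k j else 0) else 0)"
    unfolding ternary_def lookup_sum using assms
    by (intro sum.cong refl) (auto simp: lookup_single when_def)
  also have "\<dots> = (\<Sum>k'\<le>n. if k' = k then h k j else 0)"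
    using assms by (intro sum.cong) auto
  finally show ?thesis using assms by simp
qed

lemma ternary_in_forms: "ternary n h \<in> forms (int n)"
proof -
  have "mdeg m = n" if "m \<in> Poly_Mapping.keys (ternary n h)" for m
  proof -
    have "Poly_Mapping.keys (ternary n h)
        \<subseteq> (\<Union>k\<in>{..n}. \<Union>j\<in>{..k}. Poly_Mapping.keys (Poly_Mapping.single (mon (n - k) (k - j) j) (h k j)))"
      unfolding ternary_def by (rule order.trans[OF keys_sum]) (intro UN_mono order_refl keys_sum)
    with that obtain k j where "k \<le> n" "j \<le> k" "m = mon (n - k) (k - j) j"
      by (auto split: if_splits)
    then show ?thesis by (simp add: mdeg_eq)
  qed
  then show ?thesis by (simp add: forms_def)
qed

lemma forms_eq_ternary:
  assumes "g \<in> forms (int n)"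
  shows "g = ternary n (\<lambda>k j. Poly_Mapping.lookup g (mon (n - k) (k - j) j))" (is "_ = ?t")
proof (rule poly_mapping_eqI)
  fix m :: monom3
  show "Poly_Mapping.lookup g m = Poly_Mapping.lookup ?t m"
  proof (cases "mdeg m = n")
    case True
    define j k where "j = Poly_Mapping.lookup m 2" and "k = Poly_Mapping.lookup m 1 + j"
    have "m = mon (n - k) (k - j) j" "j \<le> k" "k \<le> n"
      using True mon_surj[of m] by (auto simp: j_def k_def mdeg_eq)
    then show ?thesis using lookup_ternary by simp
  next
    case False
    then have "m \<notin> Poly_Mapping.keys g" "m \<notin> Poly_Mapping.keys ?t"
      using assms ternary_in_forms[of n] by (auto simp: forms_def)
    then show ?thesis by (simp add: in_keys_iff)
  qed
qed

lemma forms_eq_range_ternary: "forms (int n) = range (ternary n)"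
proof
  show "forms (int n) \<subseteq> range (ternary n)"
    by (intro subsetI range_eqI) (rule forms_eq_ternary)
  show "range (ternary n) \<subseteq> forms (int n)"
    by (intro image_subsetI ternary_in_forms)
qed

lemma ternary_eqI:
  assumes "\<And>k j. j \<le> k \<Longrightarrow> k \<le> n \<Longrightarrow> h k j = h' k j"
  shows "ternary n h = ternary n h'"
  unfolding ternary_def using assms by (intro sum.cong) auto

lemma ternary_sum: "(\<Sum>v\<in>A. ternary n (h v)) = ternary n (\<lambda>k j. \<Sum>v\<in>A. h v k j)"
proof (induction A rule: infinite_finite_induct)
  case (insert v A)
  then show ?case by (simp add: ternary_def single_add sum.distrib)
qed (simp_all add: ternary_def)

lemma scale3_single: "scale3 c (Poly_Mapping.single m a) = Poly_Mapping.single m (c * a)"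
  by (simp add: scale3_def mult_single)

lemma scale3_ternary: "scale3 c (ternary n h) = ternary n (\<lambda>k j. c * h k j)"
  by (simp add: ternary_def poly3.scale_sum_right scale3_single)

definition lin :: "complex \<Rightarrow> complex \<Rightarrow> complex \<Rightarrow> poly3" where
  "lin x y z = Poly_Mapping.single (mon 1 0 0) x + Poly_Mapping.single (mon 0 1 0) y
     + Poly_Mapping.single (mon 0 0 1) z"

lemma lin_eq_ternary: "lin x y z = ternary 1 (\<lambda>k j. if k = 0 then x else if j = 0 then y else z)"
  by (simp add: lin_def ternary_def add_ac)

lemma lin_in_forms: "lin x y z \<in> forms 1"
  using ternary_in_forms[of 1] by (simp add: lin_eq_ternary)

lemma coords_lin [simp]: "coords (lin x y z) 0 = x" "coords (lin x y z) 1 = y" "coords (lin x y z) 2 = z"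
proof -
  have single: "Poly_Mapping.single 0 1 = mon 1 0 0" "Poly_Mapping.single 1 1 = mon 0 1 0"
    "Poly_Mapping.single 2 1 = mon 0 0 1" by (simp_all add: mon_def)
  show "coords (lin x y z) 0 = x" "coords (lin x y z) 1 = y" "coords (lin x y z) 2 = z"
    unfolding coords_def single by (simp_all add: lin_def lookup_add lookup_single)
qed

lemma forms_1_eq_lin:
  assumes "l \<in> forms 1"
  shows "l = lin (coords l 0) (coords l 1) (coords l 2)"
proof -
  have "l = ternary 1 (\<lambda>k j. Poly_Mapping.lookup l (mon (1 - k) (k - j) j))"
    using forms_eq_ternary[of l 1] assms by simp
  also have "\<dots> = lin (Poly_Mapping.lookup l (mon 1 0 0)) (Poly_Mapping.lookup l (mon 0 1 0))
      (Poly_Mapping.lookup l (mon 0 0 1))"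
    by (simp add: ternary_def lin_def add_ac)
  finally obtain x y z where "l = lin x y z" by blast
  then show ?thesis by simp
qed

lemma single_mon_power: "Poly_Mapping.single (mon a b c) x ^ n = Poly_Mapping.single (mon (n * a) (n * b) (n * c)) (x ^ n)"
proof (induction n)
  case 0
  have "mon 0 0 0 = 0" by (simp add: mon_def)
  then show ?case by simp
qed (simp add: mult_single mon_add)

lemma of_nat_mult_single: "of_nat n * Poly_Mapping.single m x = (Poly_Mapping.single m (of_nat n * x) :: poly3)"
  by (induction n) (simp_all add: distrib_right single_add)

lemma lin_power:
  "lin x y z ^ n = ternary n (\<lambda>k j. of_nat (n choose k) * of_nat (k choose j) * (x ^ (n - k) * y ^ (k - j) * z ^ j))"
proof -
  let ?s = "Poly_Mapping.single :: monom3 \<Rightarrow> complex \<Rightarrow> poly3"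
  have tail: "(?s (mon 0 1 0) y + ?s (mon 0 0 1) z) ^ k
      = (\<Sum>j\<le>k. ?s (mon 0 (k - j) j) (of_nat (k choose j) * (y ^ (k - j) * z ^ j)))" for k
  proof -
    have "(?s (mon 0 1 0) y + ?s (mon 0 0 1) z) ^ k = (?s (mon 0 0 1) z + ?s (mon 0 1 0) y) ^ k"
      by (simp add: add.commute)
    also have "\<dots> = (\<Sum>j\<le>k. of_nat (k choose j) * ?s (mon 0 0 1) z ^ j * ?s (mon 0 1 0) y ^ (k - j))"
      by (rule binomial_ring)
    also have "\<dots> = (\<Sum>j\<le>k. ?s (mon 0 (k - j) j) (of_nat (k choose j) * (y ^ (k - j) * z ^ j)))"
      by (intro sum.cong refl)
        (simp add: single_mon_power mult.assoc mult_single mon_add of_nat_mult_single mult_ac)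
    finally show ?thesis .
  qed
  have "lin x y z ^ n = ((?s (mon 0 1 0) y + ?s (mon 0 0 1) z) + ?s (mon 1 0 0) x) ^ n"
    by (simp add: lin_def add_ac)
  also have "\<dots> = (\<Sum>k\<le>n. of_nat (n choose k) * (?s (mon 0 1 0) y + ?s (mon 0 0 1) z) ^ k * ?s (mon 1 0 0) x ^ (n - k))"
    by (rule binomial_ring)
  also have "\<dots> = ternary n (\<lambda>k j. of_nat (n choose k) * of_nat (k choose j) * (x ^ (n - k) * y ^ (k - j) * z ^ j))"
    unfolding ternary_def
    unfolding tail single_mon_power sum_distrib_left sum_distrib_right
    by (intro sum.cong refl) (simp add: mult.assoc mult_single mon_add of_nat_mult_single mult_ac)
  finally show ?thesis .
qed

section \<open>Forms vanishing on a set of points\<close>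

lemma eval3_superset:
  assumes "finite M" "Poly_Mapping.keys g \<subseteq> M"
  shows "eval3 g a = (\<Sum>m\<in>M. Poly_Mapping.lookup g m * (\<Prod>i\<in>UNIV. a i ^ Poly_Mapping.lookup m i))"
  unfolding eval3_def using assms by (intro sum.mono_neutral_left) (auto simp: in_keys_iff)

lemma eval3_add: "eval3 (p + q) a = eval3 p a + eval3 q a"
proof -
  let ?M = "Poly_Mapping.keys p \<union> Poly_Mapping.keys q"
  have "Poly_Mapping.keys (p + q) \<subseteq> ?M" by (rule keys_add)
  then show ?thesis
    using eval3_superset[of ?M p a] eval3_superset[of ?M q a] eval3_superset[of ?M "p + q" a]
    by (simp add: lookup_add distrib_right sum.distrib)
qed

lemma eval3_0 [simp]: "eval3 0 a = 0"
  by (simp add: eval3_def)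

lemma eval3_sum: "eval3 (\<Sum>i\<in>A. p i) a = (\<Sum>i\<in>A. eval3 (p i) a)"
  by (induction A rule: infinite_finite_induct) (simp_all add: eval3_add)

lemma eval3_single: "eval3 (Poly_Mapping.single m c) a = c * (\<Prod>i\<in>UNIV. a i ^ Poly_Mapping.lookup m i)"
  using eval3_superset[of "{m}" "Poly_Mapping.single m c" a] by simp

lemma sum_of_monomials: "p = (\<Sum>m\<in>Poly_Mapping.keys p. Poly_Mapping.single m (Poly_Mapping.lookup p m))" for p :: poly3
  by (rule poly_mapping_eqI) (auto simp: lookup_sum lookup_single when_def in_keys_iff)

lemma eval3_mult: "eval3 (p * q) a = eval3 p a * eval3 q a"
proof -
  have single: "eval3 (Poly_Mapping.single m c * Poly_Mapping.single n d) a
      = eval3 (Poly_Mapping.single m c) a * eval3 (Poly_Mapping.single n d) a" for m n c d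
    by (simp add: mult_single eval3_single lookup_add power_add prod.distrib)
  define P where "P m = Poly_Mapping.single m (Poly_Mapping.lookup p m)" for m
  define Q where "Q n = Poly_Mapping.single n (Poly_Mapping.lookup q n)" for n
  have "p = (\<Sum>m\<in>Poly_Mapping.keys p. P m)" "q = (\<Sum>n\<in>Poly_Mapping.keys q. Q n)"
    unfolding P_def Q_def by (rule sum_of_monomials)+
  then obtain I J where p: "p = (\<Sum>m\<in>I. P m)" and q: "q = (\<Sum>n\<in>J. Q n)" by blast
  have "eval3 (p * q) a = (\<Sum>m\<in>I. \<Sum>n\<in>J. eval3 (P m * Q n) a)"
    unfolding p q by (simp only: sum_product eval3_sum)
  also have "\<dots> = (\<Sum>m\<in>I. \<Sum>n\<in>J. eval3 (P m) a * eval3 (Q n) a)"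
    unfolding P_def Q_def single ..
  also have "\<dots> = eval3 p a * eval3 q a"
    unfolding p q by (simp only: sum_product eval3_sum)
  finally show ?thesis .
qed

text \<open>The binary form \<open>\<phi>\<^sub>k\<close> in \<open>\<Sum>\<^sub>k x\<^bsup>n-k\<^esup> \<phi>\<^sub>k\<close>.\<close>

definition slice :: "nat \<Rightarrow> poly3 \<Rightarrow> nat \<Rightarrow> complex poly" where
  "slice n g k = (\<Sum>j\<le>k. monom (Poly_Mapping.lookup g (mon (n - k) (k - j) j)) j)"

lemma coeff_slice: "coeff (slice n g k) j = (if j \<le> k then Poly_Mapping.lookup g (mon (n - k) (k - j) j) else 0)"
  by (simp add: slice_def coeff_sum)

lemma degree_slice: "degree (slice n g k) \<le> k"
  by (rule degree_le) (simp add: coeff_slice)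

lemma eval3_form:
  assumes "g \<in> forms (int n)"
  shows "eval3 g a = (\<Sum>k\<le>n. a 0 ^ (n - k) * hom_eval k (slice n g k) (a 1) (a 2))"
proof -
  have "eval3 g a = (\<Sum>k\<le>n. \<Sum>j\<le>k. Poly_Mapping.lookup g (mon (n - k) (k - j) j) * (a 0 ^ (n - k) * (a 1 ^ (k - j) * a 2 ^ j)))"
  proof -
    have "eval3 g a = eval3 (ternary n (\<lambda>k j. Poly_Mapping.lookup g (mon (n - k) (k - j) j))) a"
      by (rule arg_cong[OF forms_eq_ternary[OF assms]])
    then show ?thesis by (simp add: ternary_def eval3_sum eval3_single prod_UNIV_3 mult.assoc)
  qed
  also have "\<dots> = (\<Sum>k\<le>n. a 0 ^ (n - k) * hom_eval k (slice n g k) (a 1) (a 2))"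
    unfolding hom_eval_def sum_distrib_left by (intro sum.cong) (auto simp: coeff_slice)
  finally show ?thesis .
qed

lemma hom_eval_scale: "hom_eval d p (c * y) (c * z) = c ^ d * hom_eval d p y z"
  unfolding hom_eval_def sum_distrib_left
proof (intro sum.cong refl)
  fix j assume "j \<in> {..d}"
  then have "c ^ d = c ^ (d - j) * c ^ j" by (simp flip: power_add)
  then show "coeff p j * (c * y) ^ (d - j) * (c * z) ^ j = c ^ d * (coeff p j * y ^ (d - j) * z ^ j)"
    by (simp add: power_mult_distrib mult_ac)
qed

lemma coords_scale3: "coords (scale3 c l) i = c * coords l i"
proof -
  have "scale3 c l = (\<Sum>m\<in>Poly_Mapping.keys l. Poly_Mapping.single m (c * Poly_Mapping.lookup l m))"
    unfolding scale3_single[symmetric] poly3.scale_sum_right[symmetric]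
    by (rule arg_cong[OF sum_of_monomials])
  then show ?thesis
    by (auto simp: coords_def lookup_sum lookup_single when_def in_keys_iff)
qed

lemma eval3_scale:
  assumes "g \<in> forms (int n)"
  shows "eval3 g (coords (scale3 c l)) = c ^ n * eval3 g (coords l)"
  unfolding eval3_form[OF assms] coords_scale3 hom_eval_scale sum_distrib_left
proof (intro sum.cong refl)
  fix k assume "k \<in> {..n}"
  then have "c ^ n = c ^ (n - k) * c ^ k" by (simp flip: power_add)
  then show "(c * coords l 0) ^ (n - k) * (c ^ k * hom_eval k (slice n g k) (coords l 1) (coords l 2))
      = c ^ n * (coords l 0 ^ (n - k) * hom_eval k (slice n g k) (coords l 1) (coords l 2))"
    by (simp add: power_mult_distrib mult_ac)
qed

lemma vanishes_at_proj_point: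
  assumes "g \<in> forms (int n)" "l \<noteq> 0"
  shows "vanishes_at g (proj_point l) \<longleftrightarrow> eval3 g (coords l) = 0"
proof
  assume "vanishes_at g (proj_point l)"
  moreover have "l \<in> proj_point l" by (simp add: proj_point_def poly3.span_base)
  ultimately show "eval3 g (coords l) = 0" using assms(2) by (auto simp: vanishes_at_def)
next
  assume "eval3 g (coords l) = 0"
  then show "vanishes_at g (proj_point l)"
    using eval3_scale[OF assms(1)] by (auto simp: vanishes_at_def proj_point_def poly3.span_singleton)
qed

text \<open>Evaluation is multiplicative, so the polynomials that vanish on a set of points form an ideal, and the ideal
generated by the vanishing forms contains no further forms.\<close>

lemma vanishing_ideal_forms:
  "vanishing_ideal A \<inter> forms i = {g \<in> forms i. \<forall>P\<in>A. vanishes_at g P}"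
proof -
  have "poly3_ideal.subspace {g. \<forall>P\<in>A. vanishes_at g P}"
    by (auto simp: poly3_ideal.subspace_def vanishes_at_def eval3_add eval3_mult)
  then have "vanishing_ideal A \<subseteq> {g. \<forall>P\<in>A. vanishes_at g P}"
    unfolding vanishing_ideal_def by (intro poly3_ideal.span_minimal) auto
  moreover have "g \<in> vanishing_ideal A" if "g \<in> forms i" "\<forall>P\<in>A. vanishes_at g P" for g
    unfolding vanishing_ideal_def using that by (intro poly3_ideal.span_base) auto
  ultimately show ?thesis by blast
qed

lemma forms_finite_span: "\<exists>C. finite C \<and> forms (int n) \<subseteq> poly3.span C"
proof -
  define C where "C = (\<lambda>(k, j). Poly_Mapping.single (mon (n - k) (k - j) j) (1 :: complex)) ` (SIGMA k:{..n}. {..k})"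
  have "ternary n h \<in> poly3.span C" for h
  proof -
    have "Poly_Mapping.single (mon (n - k) (k - j) j) (h k j) \<in> poly3.span C" if "k \<le> n" "j \<le> k" for k j
    proof -
      have "Poly_Mapping.single (mon (n - k) (k - j) j) 1 \<in> C"
        using that by (force simp: C_def)
      from poly3.span_scale[OF poly3.span_base[OF this], of "h k j"]
      show ?thesis by (simp add: scale3_single)
    qed
    then show ?thesis unfolding ternary_def by (intro poly3.span_sum) auto
  qed
  then have "forms (int n) \<subseteq> poly3.span C" by (auto simp: forms_eq_range_ternary)
  moreover have "finite C" by (simp add: C_def)
  ultimately show ?thesis by blast
qed

lemma dim_less_of_proper_subspace:
  assumes "poly3.subspace V" "V \<subset> W" "W \<subseteq> poly3.span C" "finite C"
  shows "poly3.dim V < poly3.dim W"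
proof -
  obtain BV where BV: "BV \<subseteq> V" "poly3.independent BV" "V \<subseteq> poly3.span BV" "card BV = poly3.dim V"
    by (rule poly3.basis_exists)
  obtain BW where BW: "BW \<subseteq> W" "poly3.independent BW" "W \<subseteq> poly3.span BW" "card BW = poly3.dim W"
    by (rule poly3.basis_exists)
  have "finite BW" using poly3.independent_span_bound[OF assms(4) BW(2)] BW(1) assms(3) by blast
  obtain x where x: "x \<in> W" "x \<notin> V" using assms(2) by blast
  have "x \<notin> poly3.span BV" using poly3.span_minimal[OF BV(1) assms(1)] x by blast
  then have "poly3.independent (insert x BV)" "x \<notin> BV"
    using BV(2) poly3.independent_insertI poly3.span_base by blast+
  then have "finite (insert x BV) \<and> card (insert x BV) \<le> card BW"
    using x BV(1) BW(3) assms(2) by (intro poly3.independent_span_bound \<open>finite BW\<close>) auto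
  moreover from this have "card (insert x BV) = Suc (card BV)"
    using \<open>x \<notin> BV\<close> by (intro card_insert_disjoint) auto
  ultimately show ?thesis using BV(4) BW(4) by simp
qed

text \<open>The two values of the Hilbert function differ by the dimensions of the spaces of vanishing forms, and a proper
inclusion of these spaces is easier to establish than the dimensions themselves.\<close>

lemma hilbert_function_neq:
  assumes "{g \<in> forms (int n). \<forall>P\<in>A. vanishes_at g P} \<subset> {g \<in> forms (int n). \<forall>P\<in>A'. vanishes_at g P}"
  shows "hilbert_function A (int n) \<noteq> hilbert_function A' (int n)"
proof -
  have forms: "poly3.subspace (forms (int n))"
  proof -
    have "poly3.subspace (range (ternary n))"
    proof (rule poly3.subspaceI)
      show "0 \<in> range (ternary n)" by (rule image_eqI[of _ _ "\<lambda>_ _. 0"]) (simp_all add: ternary_def)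
      fix p q and c :: complex
      assume "p \<in> range (ternary n)"
      then obtain h where p: "p = ternary n h" by blast
      show "scale3 c p \<in> range (ternary n)" by (simp add: p scale3_ternary)
      assume "q \<in> range (ternary n)"
      then obtain h' where q: "q = ternary n h'" by blast
      have "p + q = ternary n (\<lambda>k j. h k j + h' k j)"
        by (simp add: p q ternary_def single_add sum.distrib)
      then show "p + q \<in> range (ternary n)" by simp
    qed
    then show ?thesis by (simp only: forms_eq_range_ternary)
  qed
  have "poly3.subspace {g. \<forall>P\<in>A. vanishes_at g P}"
    by (auto simp: poly3.subspace_def vanishes_at_def eval3_add eval3_mult scale3_def)
  then have "poly3.subspace {g \<in> forms (int n). \<forall>P\<in>A. vanishes_at g P}"
    using poly3.subspace_inter[OF forms] by (simp add: Collect_conj_eq)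
  moreover obtain C where "finite C" "forms (int n) \<subseteq> poly3.span C" using forms_finite_span by blast
  ultimately have "poly3.dim {g \<in> forms (int n). \<forall>P\<in>A. vanishes_at g P}
      < poly3.dim {g \<in> forms (int n). \<forall>P\<in>A'. vanishes_at g P}"
    using assms by (intro dim_less_of_proper_subspace[of _ _ C]) auto
  then show ?thesis by (simp add: hilbert_function_def vanishing_ideal_forms)
qed

section \<open>Decompositions into twenty-two points\<close>

text \<open>The form \<open>f\<close>. By construction its decompositions are the quadrature formulas for \<open>moment\<close>; see
\<open>target_eq_sum\<close> and \<open>moments_of_power_sum\<close>.\<close>

definition target :: poly3 where
  "target = ternary 10 (\<lambda>k j. of_nat (10 choose k) * of_nat (k choose j) * moment k j)"

lemma target_in_forms: "target \<in> forms 10"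
  using ternary_in_forms[of 10] by (simp add: target_def)

lemma target_nonzero: "target \<noteq> 0"
proof
  assume "target = 0"
  moreover have "Poly_Mapping.lookup target (mon (10 - 10) (10 - 10) 10) = 4"
    unfolding target_def by (subst lookup_ternary) (simp_all add: moment_def)
  ultimately show False by simp
qed

lemma target_eq_sum:
  assumes "\<And>k j. j \<le> k \<Longrightarrow> k \<le> 10 \<Longrightarrow> (\<Sum>v\<in>A. c v * (x v ^ (10 - k) * y v ^ (k - j) * z v ^ j)) = moment k j"
  shows "target = (\<Sum>v\<in>A. scale3 (c v) (lin (x v) (y v) (z v) ^ 10))"
proof -
  have "(\<Sum>v\<in>A. scale3 (c v) (lin (x v) (y v) (z v) ^ 10))
      = ternary 10 (\<lambda>k j. \<Sum>v\<in>A. c v * (of_nat (10 choose k) * of_nat (k choose j) *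
          (x v ^ (10 - k) * y v ^ (k - j) * z v ^ j)))"
    by (simp only: lin_power scale3_ternary ternary_sum)
  also have "\<dots> = target"
    unfolding target_def
  proof (rule ternary_eqI)
    fix k j :: nat assume "j \<le> k" "k \<le> 10"
    then show "(\<Sum>v\<in>A. c v * (of_nat (10 choose k) * of_nat (k choose j) * (x v ^ (10 - k) * y v ^ (k - j) * z v ^ j)))
        = of_nat (10 choose k) * of_nat (k choose j) * moment k j"
      by (simp add: assms[symmetric] sum_distrib_left mult_ac)
  qed
  finally show ?thesis ..
qed

lemma moments_of_power_sum:
  assumes "\<And>i. i \<in> A \<Longrightarrow> l i \<in> forms 1" "target = (\<Sum>i\<in>A. l i ^ 10)" "j \<le> k" "k \<le> 10"
  shows "(\<Sum>i\<in>A. coords (l i) 0 ^ (10 - k) * coords (l i) 1 ^ (k - j) * coords (l i) 2 ^ j) = moment k j"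
proof -
  let ?b = "of_nat (10 choose k) * of_nat (k choose j) :: complex"
  have "target = (\<Sum>i\<in>A. lin (coords (l i) 0) (coords (l i) 1) (coords (l i) 2) ^ 10)"
    unfolding assms(2) using forms_1_eq_lin[OF assms(1)]
    by (intro sum.cong refl arg_cong[of _ _ "\<lambda>l. l ^ 10"])
  also have "\<dots> = ternary 10 (\<lambda>k j. \<Sum>i\<in>A. of_nat (10 choose k) * of_nat (k choose j) *
      (coords (l i) 0 ^ (10 - k) * coords (l i) 1 ^ (k - j) * coords (l i) 2 ^ j))"
    by (simp only: lin_power ternary_sum)
  finally have "Poly_Mapping.lookup target (mon (10 - k) (k - j) j)
      = (\<Sum>i\<in>A. ?b * (coords (l i) 0 ^ (10 - k) * coords (l i) 1 ^ (k - j) * coords (l i) 2 ^ j))"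
    by (rule ssubst) (rule lookup_ternary[OF assms(3,4)])
  moreover have "Poly_Mapping.lookup target (mon (10 - k) (k - j) j) = ?b * moment k j"
    unfolding target_def by (rule lookup_ternary[OF assms(3,4)])
  ultimately have "?b * (\<Sum>i\<in>A. coords (l i) 0 ^ (10 - k) * coords (l i) 1 ^ (k - j) * coords (l i) 2 ^ j) = ?b * moment k j"
    by (simp only: sum_distrib_left)
  moreover have "?b \<noteq> 0" using assms(3,4) by (simp add: binomial_eq_0_iff)
  ultimately show ?thesis by simp
qed

lemma proportional_of_common_roots:
  fixes p q :: "complex poly"
  assumes "rsquarefree q" "degree p \<le> degree q" "\<And>t. poly q t = 0 \<Longrightarrow> poly p t = 0"
  shows "\<exists>c. p = smult c q"
proof (cases "degree q = 0")
  case True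
  then obtain a b where "p = [:a:]" "q = [:b:]" using assms(2) by (metis degree_0_id le_zero_eq degree_eq_zeroE)
  moreover have "q \<noteq> 0" using assms(1) by (auto simp: rsquarefree_def)
  ultimately show ?thesis by (intro exI[of _ "a / b"]) simp
next
  case False
  have "q \<noteq> 0" using assms(1) by (auto simp: rsquarefree_def)
  define c where "c = coeff p (degree q) / lead_coeff q"
  define r where "r = p - smult c q"
  have "degree r \<le> degree q"
    unfolding r_def using assms(2) by (intro degree_diff_le) (auto intro: order.trans[OF degree_smult_le])
  moreover have "coeff r (degree q) = 0" using \<open>q \<noteq> 0\<close> by (simp add: r_def c_def)
  ultimately have "degree r < degree q"
    using False by (metis degree_0 gr0I le_neq_implies_less leading_coeff_0_iff)
  moreover have "poly r t = 0" if "poly q t = 0" for t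
    using assms(3)[OF that] that by (simp add: r_def)
  ultimately have "r = 0"
    using card_roots_rsquarefree[OF assms(1)] False by (intro poly_eqI_degree[of "{t. poly q t = 0}"]) auto
  then show ?thesis by (auto simp: r_def)
qed

text \<open>The nodes \<open>(1, t, \<rho>t)\<close> on the line with direction \<open>\<rho>\<close> have to carry the part of \<open>F\<close> on that line and a multiple \<open>w\<close> of
the value in degree ten that \<open>\<Lambda>\<close> leaves over. Multiples of the values in degrees zero and one may be added
on each line, because the three lines meet in \<open>(1:0:0)\<close> and these multiples cancel in the total as long as the degree zero ones add up to zero and the degree one ones \<open>s\<^sub>\<rho>\<close> satisfy \<open>\<Sum> s\<^sub>\<rho> (y + \<rho>z) = 0\<close>; here
\<open>s = 1, 1, -2\<close> for \<open>\<rho> = 1, -1, 0\<close>. They are chosen so that five, five and six nodes suffice. The polynomials \<open>quintic\<close> and \<open>sextic\<close> are the characteristic polynomials of recurrences that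
the resulting moment sequences (see \<open>quintic_line\<close> and \<open>sextic_line\<close>) satisfy.\<close>

definition quintic :: "complex \<Rightarrow> complex poly" where
  "quintic w = [:1, w, 0, 0, 0, -1:]"

definition sextic :: "complex \<Rightarrow> complex \<Rightarrow> complex poly" where
  "sextic u w = [:1, u, 0, -2 * w, 0, 0, 2:]"

definition points :: "complex poly \<Rightarrow> complex poly \<Rightarrow> complex poly \<Rightarrow> complex poly \<Rightarrow> (complex \<times> complex \<times> complex) set" where
  "points q1 q2 q0 q = (\<lambda>t. (1, t, t)) ` {t. poly q1 t = 0} \<union> (\<lambda>t. (1, t, - t)) ` {t. poly q2 t = 0}
     \<union> (\<lambda>t. (1, t, 0)) ` {t. poly q0 t = 0} \<union> (\<lambda>t. (0, 1, t)) ` {t. poly q t = 0}"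

lemma sum_points:
  fixes F :: "complex \<times> complex \<times> complex \<Rightarrow> 'a :: comm_monoid_add"
  assumes "poly q1 0 \<noteq> 0" "poly q2 0 \<noteq> 0" "poly q0 0 \<noteq> 0" "q \<noteq> 0"
  shows "sum F (points q1 q2 q0 q) =
    (\<Sum>t | poly q1 t = 0. F (1, t, t)) + (\<Sum>t | poly q2 t = 0. F (1, t, - t)) +
    (\<Sum>t | poly q0 t = 0. F (1, t, 0)) + (\<Sum>t | poly q t = 0. F (0, 1, t))"
    and "finite (points q1 q2 q0 q)"
proof -
  have nz: "q1 \<noteq> 0" "q2 \<noteq> 0" "q0 \<noteq> 0" using assms by auto
  define S1 S2 S0 S where "S1 = {t. poly q1 t = 0}" and "S2 = {t. poly q2 t = 0}"
    and "S0 = {t. poly q0 t = 0}" and "S = {t. poly q t = 0}"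
  have fin: "finite S1" "finite S2" "finite S0" "finite S"
    using nz assms(4) by (simp_all add: S1_def S2_def S0_def S_def poly_roots_finite)
  have ne: "0 \<notin> S1" "0 \<notin> S2" "0 \<notin> S0" using assms by (simp_all add: S1_def S2_def S0_def)
  have pts: "points q1 q2 q0 q = (\<lambda>t. (1, t, t)) ` S1 \<union> (\<lambda>t. (1, t, - t)) ` S2
     \<union> (\<lambda>t. (1, t, 0)) ` S0 \<union> (\<lambda>t. (0, 1, t)) ` S"
    by (simp add: points_def S1_def S2_def S0_def S_def)
  show "finite (points q1 q2 q0 q)" unfolding pts using fin by simp
  have disj: "(\<lambda>t. (1 :: complex, t, t)) ` S1 \<inter> (\<lambda>t. (1 :: complex, t, - t)) ` S2 = {}"
    "((\<lambda>t. (1 :: complex, t, t)) ` S1 \<union> (\<lambda>t. (1 :: complex, t, - t)) ` S2) \<inter> (\<lambda>t. (1 :: complex, t, 0)) ` S0 = {}"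
    "((\<lambda>t. (1 :: complex, t, t)) ` S1 \<union> (\<lambda>t. (1 :: complex, t, - t)) ` S2 \<union> (\<lambda>t. (1 :: complex, t, 0)) ` S0) \<inter> (\<lambda>t. (0 :: complex, 1, t)) ` S = {}"
    using ne by (auto simp: eq_neg_iff_add_eq_0)
  show "sum F (points q1 q2 q0 q) =
    (\<Sum>t | poly q1 t = 0. F (1, t, t)) + (\<Sum>t | poly q2 t = 0. F (1, t, - t)) +
    (\<Sum>t | poly q0 t = 0. F (1, t, 0)) + (\<Sum>t | poly q t = 0. F (0, 1, t))"
    unfolding pts S1_def[symmetric] S2_def[symmetric] S0_def[symmetric] S_def[symmetric]
    using fin disj by (simp add: sum.union_disjoint sum.reindex inj_on_def)
qed

text \<open>The directions \<open>1, -1, 0\<close> have the weights \<open>w1, w2, w0\<close>, and the sextic \<open>\<Lambda>\<close> is called \<open>q\<close>. The recurrence expresses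
that \<open>q\<close> annihilates \<open>B\<close> minus the weighted values in the three directions, so that this difference is a combination of
the values at the roots of \<open>q\<close>.\<close>

locale decomposition =
  fixes w1 w2 w0 :: complex and q :: "complex poly"
  assumes sqf: "rsquarefree (quintic w1)" "rsquarefree (quintic w2)"
      "rsquarefree (sextic ((w1 + w2) / 2) w0)" "rsquarefree q"
    and deg_q: "degree q = 6"
    and recurrence: "\<And>k. k \<le> 4 \<Longrightarrow>
      (\<Sum>i\<le>6. coeff q i * (moment 10 (k + i) - w1 - (-1) ^ (k + i) * w2 - (if k + i = 0 then w0 else 0))) = 0"
begin

definition pts :: "(complex \<times> complex \<times> complex) set" where
  "pts = points (quintic w1) (quintic w2) (sextic ((w1 + w2) / 2) w0) q"

lemma q_nonzero: "q \<noteq> 0"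
  using deg_q by auto

lemma degrees: "degree (quintic w) = 5" "degree (sextic u w) = 6"
  by (simp_all add: quintic_def sextic_def)

lemma values_at_0: "poly (quintic w) 0 = 1" "poly (sextic u w) 0 = 1"
  by (simp_all add: quintic_def sextic_def)

lemmas sum_pts = sum_points[of "quintic w1" "quintic w2" "sextic ((w1 + w2) / 2) w0" q,
    unfolded values_at_0, OF one_neq_zero one_neq_zero one_neq_zero q_nonzero, folded pts_def]

lemma card_pts: "card pts = 22"
proof -
  have "card pts = (\<Sum>v\<in>pts. 1)" by simp
  also have "\<dots> = 5 + 5 + 6 + 6"
    unfolding sum_pts(1) using sqf by (simp add: card_roots_rsquarefree degrees deg_q)
  finally show ?thesis by simp
qed

lemma quintic_line:
  assumes "rsquarefree (quintic w)"
  shows "\<exists>c. \<forall>k\<le>10. (\<Sum>t | poly (quintic w) t = 0. c t * t ^ k)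
    = (if k = 0 then - w else if k = 1 then 1 else if k = 6 then 1 else if k = 10 then w else 0)"
proof (rule interpolation_by_recurrence[OF _ assms])
  show "quintic w \<noteq> 0" by (simp add: quintic_def)
  fix k assume "k + degree (quintic w) \<le> 10"
  then have "k = 0 \<or> k = 1 \<or> k = 2 \<or> k = 3 \<or> k = 4 \<or> k = 5" by (auto simp: degrees)
  then show "(\<Sum>i\<le>degree (quintic w). coeff (quintic w) i *
     (if k + i = 0 then - w else if k + i = 1 then 1 else if k + i = 6 then 1 else if k + i = 10 then w else 0)) = 0"
    unfolding degrees by (elim disjE) (simp_all add: quintic_def eval_nat_numeral)
qed

lemma sextic_line:
  assumes "rsquarefree (sextic u w)"
  shows "\<exists>c. \<forall>k\<le>10. (\<Sum>t | poly (sextic u w) t = 0. c t * t ^ k)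
    = (if k = 0 then 2 * u else if k = 1 then - 2 else if k = 7 then 1 else if k = 10 then w else 0)"
proof (rule interpolation_by_recurrence[OF _ assms])
  show "sextic u w \<noteq> 0" by (simp add: sextic_def)
  fix k assume "k + degree (sextic u w) \<le> 10"
  then have "k = 0 \<or> k = 1 \<or> k = 2 \<or> k = 3 \<or> k = 4" by (auto simp: degrees)
  then show "(\<Sum>i\<le>degree (sextic u w). coeff (sextic u w) i *
     (if k + i = 0 then 2 * u else if k + i = 1 then - 2 else if k + i = 7 then 1 else if k + i = 10 then w else 0)) = 0"
    unfolding degrees by (elim disjE) (simp_all add: sextic_def eval_nat_numeral)
qed

text \<open>The moments of the four lines are added up. In degree zero and one the contributions of the three
concurrent lines cancel, and in degree ten the weights cancel against the subtracted values.\<close>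

lemma pts_moments:
  "\<exists>c. \<forall>k\<le>10. \<forall>j\<le>k. (\<Sum>v\<in>pts. c v * (fst v ^ (10 - k) * fst (snd v) ^ (k - j) * snd (snd v) ^ j)) = moment k j"
proof -
  obtain c1 where c1: "\<And>k. k \<le> 10 \<Longrightarrow> (\<Sum>t | poly (quintic w1) t = 0. c1 t * t ^ k)
    = (if k = 0 then - w1 else if k = 1 then 1 else if k = 6 then 1 else if k = 10 then w1 else 0)"
    using quintic_line[OF sqf(1)] by blast
  obtain c2 where c2: "\<And>k. k \<le> 10 \<Longrightarrow> (\<Sum>t | poly (quintic w2) t = 0. c2 t * t ^ k)
    = (if k = 0 then - w2 else if k = 1 then 1 else if k = 6 then 1 else if k = 10 then w2 else 0)"
    using quintic_line[OF sqf(2)] by blast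
  let ?q0 = "sextic ((w1 + w2) / 2) w0"
  have half: "2 * ((w1 + w2) / 2) = w1 + w2" by (simp add: field_simps)
  obtain c0 where c0: "\<And>k. k \<le> 10 \<Longrightarrow> (\<Sum>t | poly ?q0 t = 0. c0 t * t ^ k)
    = (if k = 0 then w1 + w2 else if k = 1 then - 2 else if k = 7 then 1 else if k = 10 then w0 else 0)"
    using sextic_line[OF sqf(3)] unfolding half by blast
  obtain c3 where c3: "\<And>k. k \<le> 10 \<Longrightarrow> (\<Sum>t | poly q t = 0. c3 t * t ^ k)
    = moment 10 k - w1 - (-1) ^ k * w2 - (if k = 0 then w0 else 0)"
    using interpolation_by_recurrence[OF q_nonzero sqf(4), of 10
        "\<lambda>k. moment 10 k - w1 - (-1) ^ k * w2 - (if k = 0 then w0 else 0)"] recurrence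
    by (auto simp: deg_q)
  define c where "c v = (case v of (x, y, z) \<Rightarrow>
     if x = 0 then c3 z else if z = y then c1 y else if z = - y then c2 y else c0 y)"
    for v :: "complex \<times> complex \<times> complex"
  \<comment> \<open>the case distinction identifies the line of a point, since no node of the concurrent lines lies at their common point\<close>
  have c_lines: "c (1, t, t) = c1 t" "c (0, 1, t) = c3 t" for t
    by (simp_all add: c_def)
  have c_lines': "c (1, t, - t) = c2 t" "c (1, t, 0) = c0 t" if "t \<noteq> 0" for t
  proof -
    have "t + t \<noteq> 0" using that by (simp flip: mult_2)
    then have "- t \<noteq> t" by (metis add.right_inverse)
    then show "c (1, t, - t) = c2 t" "c (1, t, 0) = c0 t" using that by (simp_all add: c_def)
  qed
  have nz: "t \<noteq> 0" if "poly (quintic w) t = 0 \<or> poly (sextic u w) t = 0" for w u t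
    using that values_at_0 by auto
  have "(\<Sum>v\<in>pts. c v * (fst v ^ (10 - k) * fst (snd v) ^ (k - j) * snd (snd v) ^ j)) = moment k j"
    if "k \<le> 10" "j \<le> k" for k j
  proof -
    have pow: "t ^ (k - j) * t ^ j = t ^ k" for t :: complex using that by (simp flip: power_add)
    have e2: "c (1, t, - t) * (1 ^ (10 - k) * t ^ (k - j) * (- t) ^ j) = c2 t * t ^ k * (-1) ^ j"
      if "poly (quintic w2) t = 0" for t
    proof -
      have "(- t) ^ j = t ^ j * (-1) ^ j" by (subst power_minus) (rule mult.commute)
      moreover have t: "t \<noteq> 0" using that nz by blast
      ultimately have "c (1, t, - t) * (1 ^ (10 - k) * t ^ (k - j) * (- t) ^ j)
          = c2 t * (t ^ (k - j) * (t ^ j * (-1) ^ j))"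
        by (simp only: c_lines'(1)[OF t] power_one mult_1_left)
      also have "\<dots> = c2 t * (t ^ (k - j) * t ^ j) * (-1) ^ j"
        by (simp only: mult.assoc)
      finally show ?thesis by (simp only: pow)
    qed
    have e1: "c (1, t, t) * (1 ^ (10 - k) * t ^ (k - j) * t ^ j) = c1 t * t ^ k" for t
      by (simp only: c_lines power_one mult_1_left pow)
    have e0: "c (1, t, 0) * (1 ^ (10 - k) * t ^ (k - j) * 0 ^ j) = c0 t * t ^ k * 0 ^ j"
      if "poly ?q0 t = 0" for t
    proof -
      have "t \<noteq> 0" using that nz by blast
      from c_lines'(2)[OF this] show ?thesis by (cases "j = 0") simp_all
    qed
    have e3: "c (0, 1, t) * (0 ^ (10 - k) * 1 ^ (k - j) * t ^ j) = c3 t * t ^ j * 0 ^ (10 - k)" for t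
      by (simp add: c_lines)
    have "(\<Sum>v\<in>pts. c v * (fst v ^ (10 - k) * fst (snd v) ^ (k - j) * snd (snd v) ^ j))
        = (\<Sum>t | poly (quintic w1) t = 0. c1 t * t ^ k)
        + (\<Sum>t | poly (quintic w2) t = 0. c2 t * t ^ k) * (-1) ^ j
        + (\<Sum>t | poly ?q0 t = 0. c0 t * t ^ k) * 0 ^ j
        + (\<Sum>t | poly q t = 0. c3 t * t ^ j) * 0 ^ (10 - k)"
      unfolding sum_pts(1) sum_distrib_right fst_conv snd_conv 
      by (rule arg_cong2[where f = "(+)"], rule arg_cong2[where f = "(+)"], rule arg_cong2[where f = "(+)"];
          rule sum.cong[OF refl], rule e1 e2 e0 e3; simp only: mem_Collect_eq)
    also have "\<dots> = moment k j"
    proof (cases "k = 1")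
      case True
      then have "j = 0 \<or> j = 1" using that by auto
      then show ?thesis using True c1[of k] c2[of k] c0[of k] c3[of j] by (auto simp: moment_def)
    next
      case False
      then show ?thesis using that c1[of k] c2[of k] c0[of k] c3[of j]
        by (cases "j = 0"; cases "k = 10") (auto simp: moment_def)
    qed
    finally show ?thesis .
  qed
  then show ?thesis by blast
qed

end

section \<open>Sextics through the points of a decomposition\<close>

lemma eval3_lin:
  assumes "g \<in> forms (int n)"
  shows "eval3 g (coords (lin x y z)) = (\<Sum>k\<le>n. x ^ (n - k) * hom_eval k (slice n g k) y z)"
  by (simp add: eval3_form[OF assms])

lemma hom_eval_on_ray:
  "degree p \<le> k \<Longrightarrow> hom_eval k p t (t * \<rho>) = t ^ k * poly p \<rho>"
  using hom_eval_scale[of k p t 1 \<rho>] by (simp add: hom_eval_at_1)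

lemma eval3_on_line:
  assumes "g \<in> forms (int n)"
  shows "eval3 g (coords (lin 1 t (t * \<rho>))) = poly (\<Sum>k\<le>n. monom (poly (slice n g k) \<rho>) k) t"
  unfolding eval3_lin[OF assms] hom_eval_on_ray[OF degree_slice]
  by (simp add: poly_sum poly_monom mult.commute)

lemma eval3_at_infinity:
  assumes "g \<in> forms (int n)"
  shows "eval3 g (coords (lin 0 y z)) = hom_eval n (slice n g n) y z"
proof -
  have "eval3 g (coords (lin 0 y z)) = (\<Sum>k\<le>n. if k = n then hom_eval n (slice n g n) y z else 0)"
    unfolding eval3_lin[OF assms] by (intro sum.cong) auto
  then show ?thesis by simp
qed

context decomposition
begin

lemma pts_cases:
  assumes "v \<in> pts"
  obtains t \<rho> where "v = (1, t, t * \<rho>)" "\<rho> \<in> {1, -1, 0}" | t where "v = (0, 1, t)" "poly q t = 0"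
proof -
  from assms consider t where "v = (1, t, t * 1)" | t where "v = (1, t, t * -1)" | t where "v = (1, t, t * 0)"
    | t where "v = (0, 1, t)" "poly q t = 0"
    by (auto simp: pts_def points_def)
  then show thesis
  proof cases
    case 1
    then show ?thesis by (intro that(1)[of _ 1]) auto
  next
    case 2
    then show ?thesis by (intro that(1)[of _ "-1"]) auto
  next
    case 3
    then show ?thesis by (intro that(1)[of _ 0]) auto
  next
    case 4
    then show ?thesis by (rule that(2))
  qed
qed

definition Z :: "poly3 set set" where
  "Z = (\<lambda>(x, y, z). proj_point (lin x y z)) ` pts"

lemma lin_pts_nonzero:
  assumes "(x, y, z) \<in> pts"
  shows "lin x y z \<noteq> 0"
proof
  assume "lin x y z = 0"
  then have "coords (lin x y z) i = 0" for i by (simp add: coords_def)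
  from this[of 0] this[of 1] have "x = 0" "y = 0" by simp_all
  with assms show False by (auto elim: pts_cases)
qed

lemma vanishes_on_Z_iff:
  assumes "g \<in> forms (int n)"
  shows "(\<forall>P\<in>Z. vanishes_at g P) \<longleftrightarrow> (\<forall>(x, y, z)\<in>pts. eval3 g (coords (lin x y z)) = 0)"
  using vanishes_at_proj_point[OF assms lin_pts_nonzero] by (auto simp: Z_def)

lemma inj_proj_point: "inj_on (\<lambda>(x, y, z). proj_point (lin x y z)) pts"
proof (rule inj_onI, clarsimp)
  fix x y z x' y' z'
  assume v: "(x, y, z) \<in> pts" and v': "(x', y', z') \<in> pts"
    and eq: "proj_point (lin x y z) = proj_point (lin x' y' z')"
  have "lin x y z \<in> proj_point (lin x y z)" by (simp add: proj_point_def poly3.span_base)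
  then obtain c where c: "lin x y z = scale3 c (lin x' y' z')"
    unfolding eq by (auto simp: proj_point_def poly3.span_singleton)
  have "coords (lin x y z) i = c * coords (lin x' y' z') i" for i
    unfolding c coords_scale3 ..
  from this[of 0] this[of 1] this[of 2] have xyz: "x = c * x'" "y = c * y'" "z = c * z'" by simp_all
  have "c = 1" using v v' xyz by (auto elim!: pts_cases)
  with xyz show "x = x' \<and> y = y' \<and> z = z'" by simp
qed

lemma finite_pts: "finite pts"
  by (rule sum_pts(2))

lemma waring_rank_target: "waring_rank 10 target = 22"
  unfolding waring_rank_def
proof (rule Least_equality)
  obtain c where c: "\<And>k j. j \<le> k \<Longrightarrow> k \<le> 10 \<Longrightarrow>
      (\<Sum>v\<in>pts. c v * (fst v ^ (10 - k) * fst (snd v) ^ (k - j) * snd (snd v) ^ j)) = moment k j"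
    using pts_moments by blast
  have "\<exists>d. d ^ 10 = c v" for v by (rule nth_root_exists) simp
  then obtain d where d: "\<And>v. d v ^ 10 = c v" by metis
  define l where "l v = scale3 (d v) (lin (fst v) (fst (snd v)) (snd (snd v)))" for v
  obtain h where h: "bij_betw h {..<22::nat} pts"
    using ex_bij_betw_nat_finite[OF finite_pts] card_pts by (auto simp: atLeast0LessThan)
  have l_forms: "l v \<in> forms 1" for v
  proof -
    have "l v = ternary 1 (\<lambda>k j. d v * (if k = 0 then fst v else if j = 0 then fst (snd v) else snd (snd v)))"
      unfolding l_def lin_eq_ternary scale3_ternary ..
    then show ?thesis using ternary_in_forms[of 1] by simp
  qed
  have "target = (\<Sum>v\<in>pts. l v ^ 10)"
    unfolding l_def scale3_power d by (rule target_eq_sum[OF c])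
  also have "\<dots> = (\<Sum>i<22. l (h i) ^ 10)"
    by (rule sum.reindex_bij_betw[OF h, symmetric])
  finally show "\<exists>l :: nat \<Rightarrow> poly3. (\<forall>i<22. l i \<in> forms 1) \<and> target = (\<Sum>i<22. l i ^ 10)"
    using l_forms by (intro exI[of _ "\<lambda>i. l (h i)"]) auto
next
  fix r assume "\<exists>l :: nat \<Rightarrow> poly3. (\<forall>i<r. l i \<in> forms 1) \<and> target = (\<Sum>i<r. l i ^ 10)"
  then obtain l :: "nat \<Rightarrow> poly3" where l: "\<And>i. i \<in> {..<r} \<Longrightarrow> l i \<in> forms 1" "target = (\<Sum>i<r. l i ^ 10)"
    by auto
  have "22 \<le> card {..<r}"
    by (rule rank_lower_bound[OF _ moments_of_power_sum[OF l]]) auto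
  then show "22 \<le> r" by simp
qed

lemma computes_rank_target: "computes_rank 10 Z target"
proof -
  obtain c where c: "\<And>k j. j \<le> k \<Longrightarrow> k \<le> 10 \<Longrightarrow>
      (\<Sum>v\<in>pts. c v * (fst v ^ (10 - k) * fst (snd v) ^ (k - j) * snd (snd v) ^ j)) = moment k j"
    using pts_moments by blast
  have "target = (\<Sum>v\<in>pts. scale3 (c v) (lin (fst v) (fst (snd v)) (snd (snd v)) ^ 10))"
    by (rule target_eq_sum[OF c])
  also have "\<dots> \<in> poly3.span (\<Union> (veronese 10 ` Z))"
  proof (intro poly3.span_sum poly3.span_scale poly3.span_base)
    fix v assume "v \<in> pts"
    then have "proj_point (lin (fst v) (fst (snd v)) (snd (snd v))) \<in> Z"
      by (auto simp: Z_def case_prod_unfold)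
    moreover have "lin (fst v) (fst (snd v)) (snd (snd v)) ^ 10
        \<in> veronese 10 (proj_point (lin (fst v) (fst (snd v)) (snd (snd v))))"
      unfolding veronese_proj_point by (simp add: proj_point_def poly3.span_base)
    ultimately show "lin (fst v) (fst (snd v)) (snd (snd v)) ^ 10 \<in> \<Union> (veronese 10 ` Z)" by blast
  qed
  finally have "apolar 10 Z target"
    using target_nonzero by (auto simp: apolar_def proj_span_def proj_def)
  moreover have "Z \<subseteq> proj (forms 1)"
    using lin_in_forms lin_pts_nonzero by (fastforce simp: Z_def proj_def)
  moreover have "card Z = 22"
    unfolding Z_def using card_image[OF inj_proj_point] card_pts by simp
  ultimately show ?thesis
    using finite_pts waring_rank_target by (simp add: computes_rank_def Z_def)
qed

text \<open>The quadrature formula for \<open>x\<^sup>4 g\<close> involves only the top slice of \<open>g\<close>, since the value of \<open>F\<close> depends on the slices of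
\<open>x\<^sup>4 g\<close> of degrees 6, 7 and 10 only, and there are none of degree more than six. This kills the top slice. What
remains has degree at most five along each of the concurrent lines, hence vanishes on the one with
six nodes and is a multiple of the quintic on the other two; the multiples are zero because the three restrictions
agree at the common point.\<close>

lemma sextics_through_pts:
  assumes g: "g \<in> forms 6" and van: "\<And>x y z. (x, y, z) \<in> pts \<Longrightarrow> eval3 g (coords (lin x y z)) = 0"
    and q: "poly q 1 + poly q (-1) \<noteq> 0"
  shows "slice 6 g 6 = 0" "\<And>k \<rho>. k \<le> 5 \<Longrightarrow> \<rho> \<in> {1, -1, 0} \<Longrightarrow> poly (slice 6 g k) \<rho> = 0"
proof -
  have g6: "g \<in> forms (int 6)" using g by simp
  have "poly (slice 6 g 6) t = 0" if "poly q t = 0" for t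
  proof -
    have "(0, 1, t) \<in> pts" using that by (auto simp: pts_def points_def)
    from van[OF this] show ?thesis
      by (simp add: eval3_at_infinity[OF g6] hom_eval_at_1 degree_slice)
  qed
  then obtain a where a: "slice 6 g 6 = smult a q"
    using proportional_of_common_roots[OF sqf(4), of "slice 6 g 6"] deg_q degree_slice[of 6 g 6] by auto
  obtain c where c: "\<And>k j. j \<le> k \<Longrightarrow> k \<le> 10 \<Longrightarrow>
      (\<Sum>v\<in>pts. c v * (fst v ^ (10 - k) * fst (snd v) ^ (k - j) * snd (snd v) ^ j)) = moment k j"
    using pts_moments by blast
  have "0 = (\<Sum>v\<in>pts. c v * fst v ^ 4 * eval3 g (coords (lin (fst v) (fst (snd v)) (snd (snd v)))))"
    using van by (intro sum.neutral[symmetric]) auto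
  also have "\<dots> = (\<Sum>v\<in>pts. \<Sum>k\<le>6. \<Sum>j\<le>k. coeff (slice 6 g k) j *
      (c v * (fst v ^ (10 - k) * fst (snd v) ^ (k - j) * snd (snd v) ^ j)))"
  proof (intro sum.cong refl)
    fix v
    have "c v * fst v ^ 4 * (fst v ^ (6 - k) * hom_eval k (slice 6 g k) (fst (snd v)) (snd (snd v)))
        = (\<Sum>j\<le>k. coeff (slice 6 g k) j * (c v * (fst v ^ (10 - k) * fst (snd v) ^ (k - j) * snd (snd v) ^ j)))"
      if "k \<le> 6" for k
    proof -
      have "10 - k = 4 + (6 - k)" using that by simp
      then show ?thesis by (simp only: power_add) (simp add: hom_eval_def sum_distrib_left mult_ac)
    qed
    then show "c v * fst v ^ 4 * eval3 g (coords (lin (fst v) (fst (snd v)) (snd (snd v))))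
        = (\<Sum>k\<le>6. \<Sum>j\<le>k. coeff (slice 6 g k) j *
      (c v * (fst v ^ (10 - k) * fst (snd v) ^ (k - j) * snd (snd v) ^ j)))"
      unfolding eval3_lin[OF g6] sum_distrib_left by (intro sum.cong refl) simp
  qed
  also have "\<dots> = (\<Sum>k\<le>6. \<Sum>j\<le>k. coeff (slice 6 g k) j * moment k j)"
    by (subst sum.swap, rule sum.cong[OF refl], subst sum.swap, rule sum.cong[OF refl])
      (simp add: c sum_distrib_left[symmetric])
  also have "\<dots> = (\<Sum>k\<le>6. moment_fun (\<lambda>_. 0) k (slice 6 g k))"
    by (intro sum.cong refl moment_fun_of_moments degree_slice) auto
  also have "\<dots> = poly (slice 6 g 6) 1 + poly (slice 6 g 6) (-1)"
    by (simp add: moment_fun_def eval_nat_numeral)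
  finally have "a * (poly q 1 + poly q (-1)) = 0" by (simp add: a distrib_left)
  with q show top: "slice 6 g 6 = 0" by (simp add: a)
  define H where "H \<rho> = (\<Sum>k\<le>5. monom (poly (slice 6 g k) \<rho>) k)" for \<rho>
  have coeff_H: "coeff (H \<rho>) k = poly (slice 6 g k) \<rho>" if "k \<le> 5" for \<rho> k
    using that by (simp add: H_def coeff_sum)
  have deg_H: "degree (H \<rho>) \<le> 5" for \<rho>
    unfolding H_def by (intro degree_sum_le) (auto intro: order.trans[OF degree_monom_le])
  have H_root: "poly (H \<rho>) t = 0" if "(1, t, t * \<rho>) \<in> pts" for \<rho> t
  proof -
    have "(\<Sum>k\<le>6. monom (poly (slice 6 g k) \<rho>) k) = H \<rho>"
    proof -
      have "{..6::nat} = insert 6 {..5}" by auto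
      then show ?thesis by (simp add: H_def top)
    qed
    then show ?thesis using van[OF that] by (simp add: eval3_on_line[OF g6])
  qed
  have "\<exists>b. H 0 = smult b (sextic ((w1 + w2) / 2) w0)"
    using deg_H[of 0] H_root[of _ 0] sqf(3)
    by (intro proportional_of_common_roots) (auto simp: degrees pts_def points_def)
  moreover have "coeff (H 0) 6 = 0" using deg_H[of 0] by (intro coeff_eq_0) simp
  ultimately have H0: "H 0 = 0" by (auto simp: sextic_def eval_nat_numeral)
  obtain b1 where b1: "H 1 = smult b1 (quintic w1)"
    using proportional_of_common_roots[OF sqf(1), of "H 1"] deg_H[of 1] H_root[of _ 1]
    by (auto simp: degrees pts_def points_def)
  obtain b2 where b2: "H (-1) = smult b2 (quintic w2)"
    using proportional_of_common_roots[OF sqf(2), of "H (-1)"] deg_H[of "-1"] H_root[of _ "-1"]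
    by (auto simp: degrees pts_def points_def)
  have "poly (slice 6 g 0) \<rho> = poly (slice 6 g 0) 0" for \<rho>
    using degree_slice[of 6 g 0] by (auto elim!: degree_eq_zeroE)
  then have "coeff (H \<rho>) 0 = 0" for \<rho>
    using coeff_H[of 0 \<rho>] coeff_H[of 0 0] H0 by simp
  from this[of 1] this[of "-1"] have "H 1 = 0" "H (-1) = 0"
    by (simp_all add: b1 b2 quintic_def)
  then show "poly (slice 6 g k) \<rho> = 0" if "k \<le> 5" "\<rho> \<in> {1, -1, 0}" for k \<rho>
    using that H0 coeff_H[of k \<rho>] by auto
qed

end

section \<open>Two decompositions with different Hilbert functions\<close>

lemma rsquarefree_quintic:
  assumes "256 * w ^ 5 \<noteq> 3125"
  shows "rsquarefree (quintic w)"
  unfolding rsquarefree_roots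
proof (intro allI notI, elim conjE)
  \<comment> \<open>a common root of the quintic and its derivative satisfies \<open>4a\<^sup>5 = -1\<close> and \<open>w = 5a\<^sup>4\<close>\<close>
  fix a assume "poly (quintic w) a = 0" "poly (pderiv (quintic w)) a = 0"
  then have 1: "1 + w * a = a ^ 5" and w: "w = 5 * a ^ 4"
    by (simp_all add: quintic_def pderiv_pCons algebra_simps power_numeral_reduce eq_neg_iff_add_eq_0)
  from 1 have a: "4 * a ^ 5 = -1"
    by (simp add: w algebra_simps power_numeral_reduce eq_neg_iff_add_eq_0)
  have "256 * w ^ 5 = 3125 * (4 * a ^ 5) ^ 4"
    by (simp add: w power_mult_distrib flip: power_mult)
  with assms show False by (simp add: a)
qed

lemma rsquarefree_sextic_0_4: "rsquarefree (sextic 0 4)"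
  unfolding rsquarefree_roots
proof (intro allI notI, elim conjE)
  fix a assume a: "poly (sextic 0 4) a = 0" "poly (pderiv (sextic 0 4)) a = 0"
  define b where "b = a ^ 3"
  have 1: "1 - 8 * b + 2 * b ^ 2 = 0" and "12 * a ^ 2 * (b - 2) = 0"
    using a by (simp_all add: b_def sextic_def pderiv_pCons algebra_simps power_numeral_reduce)
  then have "b = 0 \<or> b = 2" by (auto simp: b_def)
  with 1 show False by auto
qed

lemma rsquarefree_sextic_1_4: "rsquarefree (sextic 1 (-4))"
  unfolding rsquarefree_roots
proof (intro allI notI, elim conjE)
  fix a assume "poly (sextic 1 (-4)) a = 0" "poly (pderiv (sextic 1 (-4))) a = 0"
  then have "1 + a + 8 * a ^ 3 + 2 * a ^ 6 = 0" "1 + 24 * a ^ 2 + 12 * a ^ 5 = 0"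
    by (simp_all add: sextic_def pderiv_pCons algebra_simps power_numeral_reduce)
  \<comment> \<open>a Bezout identity from the extended Euclidean algorithm, cleared of denominators\<close>
  moreover have "(870048 - 559008 * a + 7776 * a ^ 2 + 498096 * a ^ 3 - 260136 * a ^ 4) * (1 + a + 8 * a ^ 3 + 2 * a ^ 6)
     + (15473 - 311040 * a + 179880 * a ^ 2 - 1296 * a ^ 3 - 83016 * a ^ 4 + 43356 * a ^ 5) * (1 + 24 * a ^ 2 + 12 * a ^ 5)
     = 885521"
    by (simp add: algebra_simps power_numeral_reduce)
  ultimately show False by simp
qed

text \<open>The coefficients of \<open>t\<^sup>4\<close> and \<open>t\<^sup>5\<close> are zero because \<open>\<Lambda>\<close> annihilates \<open>y\<^sup>2z\<^sup>5\<close>. The sum of the values at \<open>1\<close> and \<open>-1\<close> is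
zero for \<open>\<Lambda>\<^sub>1\<close> and nonzero for \<open>\<Lambda>\<^sub>2\<close>. The weights that belong to \<open>\<Lambda>\<close> are \<open>2/\<Lambda>(1)\<close>, \<open>2/\<Lambda>(-1)\<close> and \<open>-4/\<Lambda>(0)\<close>.\<close>

definition \<Lambda>\<^sub>1 :: "complex poly" where "\<Lambda>\<^sub>1 = [:-1, 0, 0, 1, 0, 0, 1:]"

definition \<Lambda>\<^sub>2 :: "complex poly" where "\<Lambda>\<^sub>2 = [:1, 0, 0, 0, 0, 0, 1:]"

lemma nat_le_4: "k \<le> 4 \<longleftrightarrow> k = 0 \<or> k = 1 \<or> k = 2 \<or> k = 3 \<or> k = (4::nat)"
  by auto

interpretation dec1: decomposition 2 "-2" 4 \<Lambda>\<^sub>1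
proof
  show "rsquarefree (quintic 2)" "rsquarefree (quintic (-2))" by (rule rsquarefree_quintic; simp)+
  show "rsquarefree (sextic ((2 + - 2) / 2) 4)" using rsquarefree_sextic_0_4 by simp
  show "rsquarefree \<Lambda>\<^sub>1"
    unfolding rsquarefree_roots
  proof (intro allI notI, elim conjE)
    fix a assume a: "poly \<Lambda>\<^sub>1 a = 0" "poly (pderiv \<Lambda>\<^sub>1) a = 0"
    define b where "b = a ^ 3"
    have 1: "b ^ 2 + b - 1 = 0" and 2: "3 * a ^ 2 * (2 * b + 1) = 0"
      using a by (simp_all add: b_def \<Lambda>\<^sub>1_def pderiv_pCons algebra_simps power_numeral_reduce)
    from 2 have "b = 0 \<or> 2 * b + 1 = 0" by (auto simp: b_def)
    moreover have "(2 * b + 1) ^ 2 = 4 * (b ^ 2 + b - 1) + 5"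
      by (simp add: power2_eq_square algebra_simps)
    ultimately show False using 1 by auto
  qed
  show "degree \<Lambda>\<^sub>1 = 6" by (simp add: \<Lambda>\<^sub>1_def)
  show "(\<Sum>i\<le>6. coeff \<Lambda>\<^sub>1 i * (moment 10 (k + i) - 2 - (- 1) ^ (k + i) * - 2 - (if k + i = 0 then 4 else 0))) = 0"
    if "k \<le> 4" for k
    using that unfolding nat_le_4
    by (elim disjE) (simp_all add: \<Lambda>\<^sub>1_def moment_def eval_nat_numeral)
qed

interpretation dec2: decomposition 1 1 "-4" \<Lambda>\<^sub>2
proof
  show "rsquarefree (quintic 1)" by (rule rsquarefree_quintic) simp
  show "rsquarefree (sextic ((1 + 1) / 2) (- 4))" using rsquarefree_sextic_1_4 by simp
  show "rsquarefree \<Lambda>\<^sub>2"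
    unfolding rsquarefree_roots
  proof (intro allI notI, elim conjE)
    fix a assume "poly \<Lambda>\<^sub>2 a = 0" "poly (pderiv \<Lambda>\<^sub>2) a = 0"
    then have "1 + a ^ 6 = 0" and "a = 0"
      by (simp_all add: \<Lambda>\<^sub>2_def pderiv_pCons algebra_simps power_numeral_reduce)
    then show False by simp
  qed
  show "degree \<Lambda>\<^sub>2 = 6" by (simp add: \<Lambda>\<^sub>2_def)
  show "(\<Sum>i\<le>6. coeff \<Lambda>\<^sub>2 i * (moment 10 (k + i) - 1 - (- 1) ^ (k + i) * 1 - (if k + i = 0 then - 4 else 0))) = 0"
    if "k \<le> 4" for k
    using that unfolding nat_le_4
    by (elim disjE) (simp_all add: \<Lambda>\<^sub>2_def moment_def eval_nat_numeral)
qed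

text \<open>In the usual notation this is
\[ -\textstyle\frac12 x^6 - 2x^5z - 2x^4z^2 + 4x^3y(y^2-z^2) + \frac12 xy^3z^2 + z^6 + y^3z^3 - y^6. \]
It is glued from its restrictions to the four lines: \<open>\<Lambda>\<^sub>1\<close> on \<open>x = 0\<close>, and on the others the products of \<open>-1/2 - t\<close>,
\<open>-1/2 + t\<close> and \<open>-1/2\<close> with the polynomials that define the nodes. The gluing is possible since the
three constant terms agree, the three linear terms come from a linear form, and the leading coefficients are the
values of \<open>\<Lambda>\<^sub>1\<close> in the three directions; the condition on the linear terms holds because
\<open>\<Lambda>\<^sub>1(1) + \<Lambda>\<^sub>1(-1) = 0\<close>.\<close>

definition extra_sextic :: poly3 where
  "extra_sextic = ternary 6 (\<lambda>k j. coeff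
     ([[:-1/2:], [:0, -2:], [:0, 0, -2:], [:4, 0, -4:], 0, [:0, 0, 1/2:], \<Lambda>\<^sub>1] ! k) j)"

lemma extra_sextic_form: "extra_sextic \<in> forms 6"
  using ternary_in_forms[of 6] by (simp add: extra_sextic_def)

lemma slice_extra_sextic:
  assumes "k \<le> 6"
  shows "slice 6 extra_sextic k
    = [[:-1/2:], [:0, -2:], [:0, 0, -2:], [:4, 0, -4:], 0, [:0, 0, 1/2:], \<Lambda>\<^sub>1] ! k" (is "_ = ?l ! k")
proof (rule poly_eqI)
  fix j
  have "degree (?l ! k) \<le> k"
  proof -
    have "k = 0 \<or> k = 1 \<or> k = 2 \<or> k = 3 \<or> k = 4 \<or> k = 5 \<or> k = 6" using assms by linarith
    then show ?thesis by (elim disjE) (simp_all add: \<Lambda>\<^sub>1_def)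
  qed
  then show "coeff (slice 6 extra_sextic k) j = coeff (?l ! k) j"
    using assms by (simp add: coeff_slice extra_sextic_def lookup_ternary coeff_eq_0)
qed

lemma extra_sextic_vanishes:
  assumes "(x, y, z) \<in> dec1.pts"
  shows "eval3 extra_sextic (coords (lin x y z)) = 0"
proof -
  have form: "extra_sextic \<in> forms (int 6)" using extra_sextic_form by simp
  have sum7: "(\<Sum>k\<le>6. f k) = f 0 + f 1 + f 2 + f 3 + f 4 + f 5 + f 6" for f :: "nat \<Rightarrow> complex"
    by (simp add: eval_nat_numeral)
  have line: "eval3 extra_sextic (coords (lin 1 t (t * \<rho>)))
      = - 1/2 - 2 * \<rho> * t - 2 * \<rho> ^ 2 * t ^ 2 + 4 * (1 - \<rho> ^ 2) * t ^ 3 + 1/2 * \<rho> ^ 2 * t ^ 5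
        + (\<rho> ^ 6 + \<rho> ^ 3 - 1) * t ^ 6" for t \<rho>
    unfolding eval3_on_line[OF form] poly_sum poly_monom sum7
    by (simp add: slice_extra_sextic \<Lambda>\<^sub>1_def algebra_simps power_numeral_reduce)
  have inf: "eval3 extra_sextic (coords (lin 0 1 t)) = poly \<Lambda>\<^sub>1 t" for t
    by (simp add: eval3_at_infinity[OF form] slice_extra_sextic hom_eval_at_1 \<Lambda>\<^sub>1_def)
  from assms consider t where "(x, y, z) = (1, t, t * 1)" "poly (quintic 2) t = 0"
    | t where "(x, y, z) = (1, t, t * -1)" "poly (quintic (-2)) t = 0"
    | t where "(x, y, z) = (1, t, t * 0)" "poly (sextic 0 4) t = 0"
    | t where "(x, y, z) = (0, 1, t)" "poly \<Lambda>\<^sub>1 t = 0"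
    by (auto simp: dec1.pts_def points_def)
  then show ?thesis
  proof cases
    case 1
    have "eval3 extra_sextic (coords (lin 1 t (t * 1))) = (- 1/2 - t) * poly (quintic 2) t"
      unfolding line by (simp add: quintic_def algebra_simps power_numeral_reduce)
    with 1 show ?thesis by simp
  next
    case 2
    have "eval3 extra_sextic (coords (lin 1 t (t * -1))) = (- 1/2 + t) * poly (quintic (-2)) t"
      unfolding line by (simp add: quintic_def algebra_simps power_numeral_reduce)
    with 2 show ?thesis by simp
  next
    case 3
    have "eval3 extra_sextic (coords (lin 1 t (t * 0))) = - 1/2 * poly (sextic 0 4) t"
      unfolding line by (simp add: sextic_def algebra_simps power_numeral_reduce)
    with 3 show ?thesis by simp
  next
    case 4
    then show ?thesis using inf by simp
  qed
qed

text \<open>A sextic through the second set of points vanishes on all four lines, hence on the first set as well;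
\<open>extra_sextic\<close> vanishes on the first set only.\<close>

lemma sextics_strict_inclusion:
  "{g \<in> forms (int 6). \<forall>P\<in>dec2.Z. vanishes_at g P} \<subset> {g \<in> forms (int 6). \<forall>P\<in>dec1.Z. vanishes_at g P}"
proof
  have \<Lambda>2: "poly \<Lambda>\<^sub>2 1 + poly \<Lambda>\<^sub>2 (-1) \<noteq> 0" by (simp add: \<Lambda>\<^sub>2_def)
  have forms6: "g \<in> forms 6" if "g \<in> forms (int 6)" for g using that by simp
  have slices: "slice 6 g 6 = 0" "\<And>k \<rho>. k \<le> 5 \<Longrightarrow> \<rho> \<in> {1, -1, 0} \<Longrightarrow> poly (slice 6 g k) \<rho> = 0"
    if "g \<in> forms (int 6)" "\<forall>P\<in>dec2.Z. vanishes_at g P" for g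
    using dec2.sextics_through_pts[OF forms6[OF that(1)] _ \<Lambda>2] that dec2.vanishes_on_Z_iff[OF that(1)] by blast+
  show "{g \<in> forms (int 6). \<forall>P\<in>dec2.Z. vanishes_at g P} \<subseteq> {g \<in> forms (int 6). \<forall>P\<in>dec1.Z. vanishes_at g P}"
  proof (rule Collect_mono, intro impI conjI, elim conjE, assumption, elim conjE)
    fix g assume g: "g \<in> forms (int 6)" "\<forall>P\<in>dec2.Z. vanishes_at g P"
    have "eval3 g (coords (lin x y z)) = 0" if "(x, y, z) \<in> dec1.pts" for x y z
      using that
    proof (cases rule: dec1.pts_cases)
      case (1 t \<rho>)
      have "(\<Sum>k\<le>6. monom (poly (slice 6 g k) \<rho>) k) = 0"
      proof (intro sum.neutral ballI)
        fix k :: nat assume "k \<in> {..6}"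
        then have "k \<le> 5 \<or> k = 6" by auto
        then show "monom (poly (slice 6 g k) \<rho>) k = 0"
          using slices[OF g] 1(2) by auto
      qed
      with 1(1) show ?thesis by (simp add: eval3_on_line[OF g(1)])
    next
      case (2 t)
      then show ?thesis by (simp add: eval3_at_infinity[OF g(1)] slices(1)[OF g] hom_eval_0)
    qed
    then show "\<forall>P\<in>dec1.Z. vanishes_at g P"
      unfolding dec1.vanishes_on_Z_iff[OF g(1)] by blast
  qed
  have form: "extra_sextic \<in> forms (int 6)" using extra_sextic_form by simp
  have "\<forall>P\<in>dec1.Z. vanishes_at extra_sextic P"
    unfolding dec1.vanishes_on_Z_iff[OF form] using extra_sextic_vanishes by blast
  moreover have "\<not> (\<forall>P\<in>dec2.Z. vanishes_at extra_sextic P)"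
    using slices(1)[OF form] slice_extra_sextic[of 6] by (auto simp: \<Lambda>\<^sub>1_def)
  ultimately show "{g \<in> forms (int 6). \<forall>P\<in>dec2.Z. vanishes_at g P} \<noteq> {g \<in> forms (int 6). \<forall>P\<in>dec1.Z. vanishes_at g P}"
    using form by blast
qed

theorem theorem3p1:
  "\<exists>(f :: poly3) Z1 Z2.
     f \<in> forms 10 \<and> waring_rank 10 f = 22 \<and>
     computes_rank 10 Z1 f \<and> computes_rank 10 Z2 f \<and>
     hilbert_function Z1 \<noteq> hilbert_function Z2"
proof (intro exI conjI)
  show "target \<in> forms 10" by (rule target_in_forms)
  show "waring_rank 10 target = 22" by (rule dec1.waring_rank_target)
  show "computes_rank 10 dec1.Z target" by (rule dec1.computes_rank_target)
  show "computes_rank 10 dec2.Z target" by (rule dec2.computes_rank_target)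
  show "hilbert_function dec1.Z \<noteq> hilbert_function dec2.Z"
    using hilbert_function_neq[OF sextics_strict_inclusion] by metis
qed

end
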